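(* Let $n>2$ and let $M$ be an $n$-dimensional Riemannian submanifold of $\mathbb E^{n+2}_1$ lying on $\mathcal{LC}^n\times\mathbb R$ for which the function $\alpha$ of the context vanishes at no point. Then $M$ is a $\lambda$-isotropic submanifold of $\mathbb E^{n+2}_1$ if and only if every point $p\in M$ has a neighborhood in $M$ which is congruent to the submanifold parametrized by $$\phi(s,t)=\left(\epsilon s+c_0,\ (\epsilon s+c_0)\Theta_1(t),\ (\epsilon s+c_0)\Theta_2(t),\ \dots,\ (\epsilon s+c_0)\Theta_n(t),\ s\right)$$ for a constant $c_0\in\mathbb R$ and an $\epsilon\in\{1,-1\}$, where $t=(t_2,t_3,\dots,t_n)$ and $(\Theta_1,\Theta_2,\dots,\Theta_n)$ is the position vector of the unit hypersphere $\mathbb S^{n-1}$ of the Euclidean space $\mathbb E^n$.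
   Context: $\mathbb E^{m}_1$ is $\mathbb R^m$ with the metric $\langle\cdot,\cdot\rangle=-dx_1^2+\sum_{i=2}^m dx_i^2$. $\mathcal{LC}^n\times\mathbb R=\{x\in\mathbb E^{n+2}_1: -x_1^2+x_2^2+\cdots+x_{n+1}^2=0,\ x_1>0\}$. For a Riemannian submanifold $M$, $h$ is the second fundamental form and $\nabla^\perp$ the normal connection. $M$ is $\lambda$-isotropic, for a function $\lambda\in C^\infty(M)$, if $\langle h(X,X),h(X,X)\rangle=\lambda$ for every unit vector field $X$ tangent to $M$; here "$\lambda$-isotropic" means for some $\lambda$. Congruence: two submanifolds with position vectors $\phi_1,\phi_2$ lying on $\mathcal{LC}^n\times\mathbb R$ are congruent if $\mathbf Q\circ\phi_1=\phi_2$ for a rotation $\mathbf Q$ on the hyperplane $x_{n+2}=0$ of $\mathbb E^{n+2}_1$ (identified with $\mathbb E^{n+1}_1$), i.e. a linear isometry of $\mathbb E^{n+1}_1$ acting on the first $n+1$ coordinates and leaving $x_{n+2}$ fixed. The function $\alpha$ of $M$: if $\phi=(\phi_1,\dots,\phi_{n+2})$ is the position vector of $M$, then $\theta=(\phi_1,\dots,\phi_{n+1},0)$ is a light-like normal field along $M$, and with $e_1=(\partial_{x_{n+2}})^T$ the tangential part of $\partial_{x_{n+2}}|_M$, $\alpha\in C^\infty(M)$ is defined by $\nabla^\perp_{e_1}\theta=\alpha\theta$, equivalently $\partial_{x_{n+2}}|_M=e_1-\alpha\theta$. *)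

theory Defs
  imports "HOL-Analysis.Analysis"
begin

section \<open>Smooth maps on open subsets of Euclidean spaces\<close>

text \<open>Only meaningful for open \<^term>\<open>S\<close>: all iterated directional derivatives up to order
  \<^term>\<open>k\<close> exist and are continuous.\<close>

primrec Ck_on :: "nat \<Rightarrow> 'a::euclidean_space set \<Rightarrow> ('a \<Rightarrow> 'b::real_normed_vector) \<Rightarrow> bool" where
  "Ck_on 0 S f \<longleftrightarrow> continuous_on S f"
| "Ck_on (Suc k) S f \<longleftrightarrow>
     f differentiable_on S \<and> (\<forall>v. Ck_on k S (\<lambda>x. frechet_derivative f (at x) v))"

definition smooth_on :: "'a::euclidean_space set \<Rightarrow> ('a \<Rightarrow> 'b::real_normed_vector) \<Rightarrow> bool" where
  "smooth_on S f \<longleftrightarrow> (\<forall>k. Ck_on k S f)"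

section \<open>Smooth manifolds and differentiation in charts\<close>

text \<open>A chart is a pair \<open>(U, \<psi>)\<close> of its domain and its coordinate map; only the values of \<open>\<psi>\<close> on
  \<open>U\<close> matter, and \<open>inv_into U \<psi>\<close> is the local parametrization that belongs to it. The dimension
  of the manifold is that of the Euclidean space \<open>'c\<close>.\<close>

type_synonym ('m, 'c) chart = "'m set \<times> ('m \<Rightarrow> 'c)"

definition smooth_manifold :: "'m topology \<Rightarrow> ('m, 'c::euclidean_space) chart set \<Rightarrow> bool" where
  "smooth_manifold M A \<longleftrightarrow>
     Hausdorff_space M \<and> second_countable M \<and>
     (\<Union>(U, \<psi>)\<in>A. U) = topspace M \<and>
     (\<forall>(U, \<psi>)\<in>A. openin M U \<and> open (\<psi> ` U) \<and>
        homeomorphic_map (subtopology M U) (top_of_set (\<psi> ` U)) \<psi>) \<and>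
     (\<forall>(U, \<psi>)\<in>A. \<forall>(V, \<psi>')\<in>A. smooth_on (\<psi> ` (U \<inter> V)) (\<psi>' \<circ> inv_into U \<psi>))"

text \<open>Smoothness of a map on an open subset \<^term>\<open>W\<close> of the manifold.\<close>

definition smooth_map :: "('m, 'c::euclidean_space) chart set \<Rightarrow> 'm set \<Rightarrow>
    ('m \<Rightarrow> 'b::real_normed_vector) \<Rightarrow> bool" where
  "smooth_map A W F \<longleftrightarrow> (\<forall>(U, \<psi>)\<in>A. smooth_on (\<psi> ` (U \<inter> W)) (F \<circ> inv_into U \<psi>))"

fun chart_deriv :: "('m, 'c::euclidean_space) chart \<Rightarrow> ('m \<Rightarrow> 'b::real_normed_vector) \<Rightarrow> 'm \<Rightarrow>
    'c \<Rightarrow> 'b" where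
  "chart_deriv (U, \<psi>) F p = frechet_derivative (F \<circ> inv_into U \<psi>) (at (\<psi> p))"

section \<open>The Lorentz-Minkowski space\<close>

text \<open>With \<open>n = CARD('n)\<close>, a point \<open>(a, y, b)\<close> has the coordinates \<open>x\<^sub>1 = a\<close>,
  \<open>(x\<^sub>2, \<dots>, x\<^bsub>n+1\<^esub>) = y\<close> and \<open>x\<^bsub>n+2\<^esub> = b\<close>.\<close>

type_synonym 'n minkowski = "real \<times> (real ^ 'n) \<times> real"

fun mink :: "'n::finite minkowski \<Rightarrow> 'n minkowski \<Rightarrow> real" where
  "mink (a, y, b) (a', y', b') = - (a * a') + (\<Sum>i\<in>UNIV. y $ i * y' $ i) + b * b'"

definition light_cone_cylinder :: "'n::finite minkowski set" where
  "light_cone_cylinder = {(a, y, b). - (a\<^sup>2) + (\<Sum>i\<in>UNIV. (y $ i)\<^sup>2) = 0 \<and> 0 < a}"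

text \<open>A linear isometry \<^term>\<open>L\<close> of the hyperplane \<open>x\<^bsub>n+2\<^esub> = 0\<close>, acting on the first
  \<open>n + 1\<close> coordinates.\<close>

definition hyperplane_rotation :: "('n::finite minkowski \<Rightarrow> 'n minkowski) \<Rightarrow> bool" where
  "hyperplane_rotation Q \<longleftrightarrow>
     (\<exists>L :: real \<times> (real ^ 'n) \<Rightarrow> real \<times> (real ^ 'n).
        linear L \<and>
        (\<forall>u v. mink (fst (L u), snd (L u), 0) (fst (L v), snd (L v), 0) =
               mink (fst u, snd u, 0) (fst v, snd v, 0)) \<and>
        (\<forall>a y b. Q (a, y, b) = (fst (L (a, y)), snd (L (a, y)), b)))"

section \<open>Immersed Riemannian submanifolds\<close>

text \<open>A submanifold is a manifold \<open>(M, A)\<close> together with its position vector \<open>\<phi>\<close>, an immersion.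
  Tangent vectors of the manifold at \<^term>\<open>p\<close> are identified with their images under the
  differential of \<open>\<phi>\<close>. That image is the same for all charts around \<^term>\<open>p\<close>.\<close>

definition tangent_space :: "('m, 'c::euclidean_space) chart set \<Rightarrow> ('m \<Rightarrow> 'n::finite minkowski) \<Rightarrow>
    'm \<Rightarrow> 'n minkowski set" where
  "tangent_space A \<phi> p = (\<Union>c\<in>{c \<in> A. p \<in> fst c}. range (chart_deriv c \<phi> p))"

definition riemannian_submanifold :: "'m topology \<Rightarrow> ('m, 'c::euclidean_space) chart set \<Rightarrow>
    ('m \<Rightarrow> 'n::finite minkowski) \<Rightarrow> bool" where
  "riemannian_submanifold M A \<phi> \<longleftrightarrow>
     smooth_manifold M A \<and> smooth_map A (topspace M) \<phi> \<and>
     (\<forall>c\<in>A. \<forall>p\<in>fst c. inj (chart_deriv c \<phi> p)) \<and>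
     (\<forall>p\<in>topspace M. \<forall>v\<in>tangent_space A \<phi> p. v \<noteq> 0 \<longrightarrow> 0 < mink v v)"

definition normal_space :: "('m, 'c::euclidean_space) chart set \<Rightarrow> ('m \<Rightarrow> 'n::finite minkowski) \<Rightarrow>
    'm \<Rightarrow> 'n minkowski set" where
  "normal_space A \<phi> p = {w. \<forall>v\<in>tangent_space A \<phi> p. mink v w = 0}"

definition tangential_part :: "('m, 'c::euclidean_space) chart set \<Rightarrow> ('m \<Rightarrow> 'n::finite minkowski) \<Rightarrow>
    'm \<Rightarrow> 'n minkowski \<Rightarrow> 'n minkowski" where
  "tangential_part A \<phi> p w = (THE v. v \<in> tangent_space A \<phi> p \<and> w - v \<in> normal_space A \<phi> p)"

definition normal_part :: "('m, 'c::euclidean_space) chart set \<Rightarrow> ('m \<Rightarrow> 'n::finite minkowski) \<Rightarrow>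
    'm \<Rightarrow> 'n minkowski \<Rightarrow> 'n minkowski" where
  "normal_part A \<phi> p w = w - tangential_part A \<phi> p w"

text \<open>The flat connection of the ambient space: the derivative at \<^term>\<open>p\<close> of a field \<^term>\<open>F\<close>
  along the submanifold in the direction of the tangent vector \<^term>\<open>v\<close>. In a chart around
  \<^term>\<open>p\<close>, this vector is represented by a unique \<^term>\<open>a\<close>, and the value does not depend on
  the chart.\<close>

definition ambient_deriv :: "('m, 'c::euclidean_space) chart set \<Rightarrow> ('m \<Rightarrow> 'n::finite minkowski) \<Rightarrow>
    'm \<Rightarrow> 'n minkowski \<Rightarrow> ('m \<Rightarrow> 'n minkowski) \<Rightarrow> 'n minkowski" where
  "ambient_deriv A \<phi> p v F =
     (THE w. \<exists>c\<in>A. \<exists>a. p \<in> fst c \<and> chart_deriv c \<phi> p a = v \<and> chart_deriv c F p a = w)"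

definition second_fundamental_form :: "('m, 'c::euclidean_space) chart set \<Rightarrow>
    ('m \<Rightarrow> 'n::finite minkowski) \<Rightarrow> ('m \<Rightarrow> 'n minkowski) \<Rightarrow> ('m \<Rightarrow> 'n minkowski) \<Rightarrow>
    'm \<Rightarrow> 'n minkowski" where
  "second_fundamental_form A \<phi> X Y p = normal_part A \<phi> p (ambient_deriv A \<phi> p (X p) Y)"

definition normal_connection :: "('m, 'c::euclidean_space) chart set \<Rightarrow>
    ('m \<Rightarrow> 'n::finite minkowski) \<Rightarrow> ('m \<Rightarrow> 'n minkowski) \<Rightarrow> ('m \<Rightarrow> 'n minkowski) \<Rightarrow>
    'm \<Rightarrow> 'n minkowski" where
  "normal_connection A \<phi> X \<xi> p = normal_part A \<phi> p (ambient_deriv A \<phi> p (X p) \<xi>)"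

text \<open>Unit tangent fields are taken on arbitrary open subsets, since a unit tangent vector need
  not extend to a unit field on the whole manifold.\<close>

definition isotropic :: "'m topology \<Rightarrow> ('m, 'c::euclidean_space) chart set \<Rightarrow>
    ('m \<Rightarrow> 'n::finite minkowski) \<Rightarrow> ('m \<Rightarrow> real) \<Rightarrow> bool" where
  "isotropic M A \<phi> l \<longleftrightarrow>
     smooth_map A (topspace M) l \<and>
     (\<forall>U X. openin M U \<and> smooth_map A U X \<and>
        (\<forall>p\<in>U. X p \<in> tangent_space A \<phi> p \<and> mink (X p) (X p) = 1) \<longrightarrow>
        (\<forall>p\<in>U. mink (second_fundamental_form A \<phi> X X p) (second_fundamental_form A \<phi> X X p) = l p))"

section \<open>The function \<open>\<alpha>\<close> of a submanifold of the light cone cylinder\<close>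

definition theta_field :: "('m \<Rightarrow> 'n::finite minkowski) \<Rightarrow> 'm \<Rightarrow> 'n minkowski" where
  "theta_field \<phi> p = (case \<phi> p of (a, y, b) \<Rightarrow> (a, y, 0))"

definition e1_field :: "('m, 'c::euclidean_space) chart set \<Rightarrow> ('m \<Rightarrow> 'n::finite minkowski) \<Rightarrow>
    'm \<Rightarrow> 'n minkowski" where
  "e1_field A \<phi> p = tangential_part A \<phi> p (0, 0, 1)"

definition alpha :: "('m, 'c::euclidean_space) chart set \<Rightarrow> ('m \<Rightarrow> 'n::finite minkowski) \<Rightarrow>
    'm \<Rightarrow> real" where
  "alpha A \<phi> p =
     (THE r. normal_connection A \<phi> (e1_field A \<phi>) (theta_field \<phi>) p = r *\<^sub>R theta_field \<phi> p)"

section \<open>Congruence with a parametrized submanifold\<close>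

text \<open>The open subset \<^term>\<open>N\<close> of the submanifold is congruent to the submanifold parametrized by
  \<open>\<Phi>\<close> on the open set \<^term>\<open>W\<close>: a diffeomorphism \<^term>\<open>g\<close> from \<^term>\<open>N\<close> onto \<^term>\<open>W\<close> identifies
  the two manifolds, and a rotation carries one position vector to the other.\<close>

definition congruent_to_parametrized :: "'m topology \<Rightarrow> ('m, 'c::euclidean_space) chart set \<Rightarrow>
    ('m \<Rightarrow> 'n::finite minkowski) \<Rightarrow> 'm set \<Rightarrow> 'w::euclidean_space set \<Rightarrow> ('w \<Rightarrow> 'n minkowski) \<Rightarrow>
    bool" where
  "congruent_to_parametrized M A \<phi> N W \<Phi> \<longleftrightarrow>
     (\<exists>Q g. hyperplane_rotation Q \<and>
        homeomorphic_map (subtopology M N) (top_of_set W) g \<and>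
        smooth_map A N g \<and>
        (\<forall>(U, \<psi>)\<in>A. smooth_on (g ` (N \<inter> U)) (\<psi> \<circ> inv_into N g)) \<and>
        (\<forall>q\<in>N. Q (\<phi> q) = \<Phi> (g q)))"

text \<open>\<open>\<Theta>\<close> is the position vector of (an open part of) the unit sphere in local coordinates
  \<^term>\<open>t\<close>; to be used with \<open>CARD('k) = CARD('n) - 1\<close>.\<close>

definition sphere_parametrization :: "(real ^ 'k::finite) set \<Rightarrow> (real ^ 'k \<Rightarrow> real ^ 'n::finite) \<Rightarrow>
    bool" where
  "sphere_parametrization T \<Theta> \<longleftrightarrow>
     open T \<and> smooth_on T \<Theta> \<and> \<Theta> ` T \<subseteq> sphere 0 1 \<and> inj_on \<Theta> T \<and>
     (\<forall>t\<in>T. inj (frechet_derivative \<Theta> (at t)))"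

fun cone_parametrization :: "real \<Rightarrow> real \<Rightarrow> (real ^ 'k::finite \<Rightarrow> real ^ 'n::finite) \<Rightarrow>
    real \<times> (real ^ 'k) \<Rightarrow> 'n minkowski" where
  "cone_parametrization \<epsilon> c\<^sub>0 \<Theta> (s, t) = (\<epsilon> * s + c\<^sub>0, (\<epsilon> * s + c\<^sub>0) *\<^sub>R \<Theta> t, s)"

end

theory Submission
  imports Defs
begin

text \<open>Write \<open>\<partial>\<close> for the last coordinate vector \<open>(0, 0, 1)\<close> and \<open>\<theta>\<close> for the position vector with its last
coordinate deleted. Along a submanifold \<open>M\<close> of the cylinder \<open>\<theta>\<close> is a light-like normal field, so
the normal spaces are Lorentzian planes. A normal vector orthogonal to \<open>\<theta>\<close> is a multiple of \<open>\<theta>\<close>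
(\<open>normal_orthogonal_null_line\<close>); in particular \<open>\<partial> = e\<^sub>1 - \<alpha>\<theta>\<close>, where \<open>e\<^sub>1\<close> is a unit tangent vector,
and \<open>\<alpha> \<noteq> 0\<close> means that \<open>\<partial>\<close> is not tangent to \<open>M\<close>.

Differentiating \<open>\<langle>X, \<theta>\<rangle> = 0\<close> gives \<open>\<langle>h(X, X), \<theta>\<rangle> = - (\<langle>X, X\<rangle> - \<langle>X, e\<^sub>1\<rangle>\<^sup>2)\<close>. Hence \<open>h(e\<^sub>1, e\<^sub>1)\<close> is
orthogonal to \<open>\<theta>\<close>, so it is a multiple of \<open>\<theta>\<close> and light-like: an isotropic \<open>M\<close> has \<open>\<lambda> = 0\<close>, and
\<open>h(X, X)\<close> is light-like for every \<open>X\<close>. For \<open>X\<close> not proportional to \<open>e\<^sub>1\<close> it is not a multiple of \<open>\<theta>\<close>,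
so it spans the second light-like line of the normal plane. Let \<open>N\<close> be the vector of this line with
\<open>\<langle>N, \<partial>\<rangle> = 1\<close>; it exists because \<open>\<partial>\<close> is not tangent. Now \<open>\<langle>h(X, X), N\<rangle> = 0\<close> for all \<open>X\<close> off the line
of \<open>e\<^sub>1\<close>, and a quadratic form that vanishes there vanishes identically. Therefore the derivative of
\<open>N\<close> is normal; it is also orthogonal to \<open>N\<close> and to \<open>\<partial>\<close>, because \<open>\<langle>N, N\<rangle>\<close> and \<open>\<langle>N, \<partial>\<rangle>\<close> are
constant, and so it is zero (\<open>null_normal_derivative_0\<close>). So \<open>N\<close> is locally a constant vector,
and \<open>\<langle>N, \<phi>\<rangle>\<close> is locally constant since \<open>N\<close> is normal (\<open>lies_on_null_hyperplane\<close>): locally, \<open>M\<close> lies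
on a degenerate hyperplane.

The part of \<open>N\<close> in the hyperplane \<open>x\<^bsub>n+2\<^esub> = 0\<close> is a unit time-like vector, which a rotation moves to
\<open>(\<epsilon>, 0)\<close>. After this rotation the equation \<open>\<langle>N, \<phi>\<rangle> = k\<close> reads \<open>x\<^sub>1 = \<epsilon> s - \<epsilon> k\<close> with \<open>s = x\<^bsub>n+2\<^esub>\<close>,
and the cone condition turns \<open>(x\<^sub>2, \<dots>, x\<^bsub>n+1\<^esub>)\<close> into \<open>x\<^sub>1\<close> times a point of the sphere. This is the
parametrization of the theorem, with \<open>s\<close> and the stereographic coordinates of that point as
parameters (\<open>local_cone_form\<close>); the inverse function theorem shows that they are local coordinates
of \<open>M\<close>.

Conversely, if \<open>M\<close> locally satisfies such an equation \<open>\<langle>N, \<phi>\<rangle> = k\<close>, then \<open>N\<close> is a constant normal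
vector, so every \<open>h(X, X)\<close> is orthogonal to \<open>N\<close>, hence a multiple of \<open>N\<close> and light-like
(\<open>second_fundamental_form_null\<close>). Thus \<open>M\<close> is isotropic with \<open>\<lambda> = 0\<close>.\<close>

section \<open>Closure properties of differentiability classes\<close>

text \<open>For an open set, agreement of two functions on the set carries over to their derivatives there,
so nothing depends on the values outside.\<close>

lemma Ck_on_cong:
  assumes "open S" "Ck_on k S f" "\<And>x. x \<in> S \<Longrightarrow> f x = g x"
  shows "Ck_on k S g"
  using assms(2,3)
proof (induction k arbitrary: f g)
  case 0 then show ?case by (simp cong: continuous_on_cong)
next
  case (Suc k)
  have D: "(g has_derivative frechet_derivative f (at x)) (at x)" if "x \<in> S" for x
  proof (rule has_derivative_transform_within_open[OF _ \<open>open S\<close> that])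
    show "(f has_derivative frechet_derivative f (at x)) (at x)"
      using Suc.prems(1) that \<open>open S\<close>
      by (simp add: differentiable_on_eq_differentiable_at frechet_derivative_works)
  qed (use Suc.prems in auto)
  then have "g differentiable_on S"
    by (metis differentiableI differentiable_at_imp_differentiable_on)
  moreover have "Ck_on k S (\<lambda>x. frechet_derivative g (at x) v)" for v
  proof (rule Suc.IH)
    show "Ck_on k S (\<lambda>x. frechet_derivative f (at x) v)"
      using Suc.prems(1) by simp
    show "frechet_derivative f (at x) v = frechet_derivative g (at x) v" if "x \<in> S" for x
      using frechet_derivative_at[OF D[OF that]] by simp
  qed
  ultimately show ?case by simp
qed

text \<open>Lets one establish \<^term>\<open>Ck_on (Suc k) S f\<close> from an explicit formula for the derivative; all the
closure properties below are inductions with the usual rule of differentiation as this formula.\<close>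

lemma Ck_on_SucI:
  assumes "open S" "\<And>x. x \<in> S \<Longrightarrow> (f has_derivative D x) (at x)" "\<And>v. Ck_on k S (\<lambda>x. D x v)"
  shows "Ck_on (Suc k) S f"
proof -
  have "f differentiable_on S"
    using assms(2) by (metis differentiableI differentiable_at_imp_differentiable_on)
  moreover have "Ck_on k S (\<lambda>x. frechet_derivative f (at x) v)" for v
  proof (rule Ck_on_cong[OF \<open>open S\<close> assms(3)[of v]])
    show "D x v = frechet_derivative f (at x) v" if "x \<in> S" for x
      using frechet_derivative_at[OF assms(2)[OF that]] by simp
  qed
  ultimately show ?thesis by simp
qed

lemma Ck_on_Suc_has_derivative:
  assumes "open S" "Ck_on (Suc k) S f" "x \<in> S"
  shows "(f has_derivative frechet_derivative f (at x)) (at x)"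
  using assms by (simp add: differentiable_on_eq_differentiable_at frechet_derivative_works)

lemma Ck_on_subset: "Ck_on k S f \<Longrightarrow> T \<subseteq> S \<Longrightarrow> Ck_on k T f"
proof (induction k arbitrary: f)
  case 0 then show ?case by (simp add: continuous_on_subset)
next
  case (Suc k) then show ?case by (auto intro: differentiable_on_subset)
qed

lemma Ck_on_SucD: "Ck_on (Suc k) S f \<Longrightarrow> Ck_on k S f"
proof (induction k arbitrary: f)
  case 0 then show ?case by (simp add: differentiable_imp_continuous_on)
next
  case (Suc k)
  then show ?case by (metis Ck_on.simps(2))
qed

lemma Ck_on_imp_continuous: "Ck_on k S f \<Longrightarrow> continuous_on S f"
  by (induction k) (auto intro: differentiable_imp_continuous_on)

lemma Ck_on_const: "Ck_on k S (\<lambda>x. c)"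
proof (induction k arbitrary: c)
  case (Suc k) then show ?case by simp
qed simp

lemma Ck_on_linear:
  assumes "open S" "bounded_linear L" "Ck_on k S f"
  shows "Ck_on k S (\<lambda>x. L (f x))"
  using assms(3)
proof (induction k arbitrary: f)
  case 0 then show ?case
    using bounded_linear.continuous_on[OF assms(2)] by simp
next
  case (Suc k)
  show ?case
  proof (rule Ck_on_SucI[OF \<open>open S\<close>])
    fix x assume "x \<in> S"
    from Ck_on_Suc_has_derivative[OF \<open>open S\<close> Suc.prems this]
    show "((\<lambda>x. L (f x)) has_derivative (\<lambda>v. L (frechet_derivative f (at x) v))) (at x)"
      using bounded_linear.has_derivative[OF assms(2)] by blast
  qed (use Suc in auto)
qed

lemma Ck_on_id:
  assumes "open S" shows "Ck_on k S (\<lambda>x. x)"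
proof (cases k)
  case (Suc m)
  then show ?thesis
    by (simp add: differentiable_on_ident Ck_on_const)
qed simp

lemma Ck_on_add:
  assumes "open S" "Ck_on k S f" "Ck_on k S g"
  shows "Ck_on k S (\<lambda>x. f x + g x)"
  using assms(2,3)
proof (induction k arbitrary: f g)
  case 0 then show ?case by (simp add: continuous_on_add)
next
  case (Suc k)
  show ?case
  proof (rule Ck_on_SucI[OF \<open>open S\<close>])
    fix x assume "x \<in> S"
    then show "((\<lambda>x. f x + g x) has_derivative
        (\<lambda>v. frechet_derivative f (at x) v + frechet_derivative g (at x) v)) (at x)"
      using Ck_on_Suc_has_derivative[OF \<open>open S\<close>] Suc.prems by (blast intro: has_derivative_add)
  qed (use Suc in auto)
qed

lemma Ck_on_sum:
  assumes "open S" "\<And>i. i \<in> I \<Longrightarrow> Ck_on k S (f i)"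
  shows "Ck_on k S (\<lambda>x. \<Sum>i\<in>I. f i x)"
  using assms(2)
  by (induction I rule: infinite_finite_induct) (auto simp: Ck_on_const intro: Ck_on_add[OF \<open>open S\<close>])

text \<open>By the Leibniz rule the derivative is a sum of two terms of the same shape, so the induction
runs with both factors arbitrary.\<close>

lemma Ck_on_bilinear:
  assumes "open S" "bounded_bilinear P" "Ck_on k S f" "Ck_on k S g"
  shows "Ck_on k S (\<lambda>x. P (f x) (g x))"
  using assms(3,4)
proof (induction k arbitrary: f g)
  case 0 then show ?case
    using bounded_bilinear.continuous_on[OF assms(2)] by simp
next
  case (Suc k)
  show ?case
  proof (rule Ck_on_SucI[OF \<open>open S\<close>])
    fix x assume "x \<in> S"
    then show "((\<lambda>x. P (f x) (g x)) has_derivative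
        (\<lambda>v. P (f x) (frechet_derivative g (at x) v) + P (frechet_derivative f (at x) v) (g x))) (at x)"
      using Suc.prems by (intro bounded_bilinear.FDERIV[OF assms(2)] Ck_on_Suc_has_derivative[OF \<open>open S\<close>])
  next
    fix v
    show "Ck_on k S (\<lambda>x. P (f x) (frechet_derivative g (at x) v) + P (frechet_derivative f (at x) v) (g x))"
      using Suc.prems by (intro Ck_on_add[OF \<open>open S\<close>] Suc.IH Ck_on_SucD[of k S f] Ck_on_SucD[of k S g]) simp_all
  qed
qed

text \<open>The class of order \<open>k\<close> tests the derivative in fixed directions only, whereas the chain rule
evaluates the derivative of \<^term>\<open>f\<close> in the moving direction \<^term>\<open>frechet_derivative g (at x) v\<close>.
Expanding that direction in a basis reduces the claim to products.\<close>

lemma Ck_on_compose: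
  fixes f :: "'b::euclidean_space \<Rightarrow> 'c::real_normed_vector"
  assumes "open S" "open T" "Ck_on k T f" "Ck_on k S g" "g ` S \<subseteq> T"
  shows "Ck_on k S (\<lambda>x. f (g x))"
  using assms(3,4)
proof (induction k arbitrary: f)
  case 0 then show ?case
    using assms(5) continuous_on_compose2[of T f S g] by simp
next
  case (Suc k)
  show ?case
  proof (rule Ck_on_SucI[OF \<open>open S\<close>])
    fix x assume x: "x \<in> S"
    let ?D = "frechet_derivative f (at (g x))"
    have df: "(f has_derivative ?D) (at (g x))"
      using x assms(5) by (intro Ck_on_Suc_has_derivative[OF \<open>open T\<close> Suc.prems(1)]) auto
    have dg: "(g has_derivative frechet_derivative g (at x)) (at x)"
      using x by (rule Ck_on_Suc_has_derivative[OF \<open>open S\<close> Suc.prems(2)])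
    have eq: "?D w = (\<Sum>b\<in>Basis. (w \<bullet> b) *\<^sub>R ?D b)" for w
      using linear_sum[OF has_derivative_linear[OF df], of "\<lambda>b. (w \<bullet> b) *\<^sub>R b" Basis]
      by (simp add: euclidean_representation linear_scale[OF has_derivative_linear[OF df]])
    show "((\<lambda>x. f (g x)) has_derivative
        (\<lambda>v. \<Sum>b\<in>Basis. (frechet_derivative g (at x) v \<bullet> b) *\<^sub>R frechet_derivative f (at (g x)) b)) (at x)"
      by (rule has_derivative_eq_rhs[OF has_derivative_compose[OF dg df]]) (rule ext, rule eq)
  next
    fix v
    show "Ck_on k S (\<lambda>x. \<Sum>b\<in>Basis. (frechet_derivative g (at x) v \<bullet> b) *\<^sub>R frechet_derivative f (at (g x)) b)"
    proof (intro Ck_on_sum[OF \<open>open S\<close>] Ck_on_bilinear[OF \<open>open S\<close> bounded_bilinear_scaleR])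
      fix b :: 'b
      show "Ck_on k S (\<lambda>x. frechet_derivative g (at x) v \<bullet> b)"
        using Suc.prems(2) by (intro Ck_on_linear[OF \<open>open S\<close> bounded_linear_inner_left]) simp
      show "Ck_on k S (\<lambda>x. frechet_derivative f (at (g x)) b)"
        using Suc.prems by (intro Suc.IH Ck_on_SucD[of k S g]) simp_all
    qed
  qed
qed

lemma Ck_on_inverse_real: "Ck_on k (- {0}) (inverse :: real \<Rightarrow> real)"
proof (induction k)
  case 0 show ?case by (auto intro!: continuous_intros)
next
  case (Suc k)
  show ?case
  proof (rule Ck_on_SucI)
    fix v :: real
    show "Ck_on k (- {0}) (\<lambda>x. - (inverse x * v * inverse x))"
      by (intro Ck_on_linear[OF _ bounded_linear_minus[OF bounded_linear_ident]]
        Ck_on_bilinear[OF _ bounded_bilinear_mult] Suc Ck_on_const open_Compl) auto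
  qed (auto intro!: has_derivative_inverse')
qed

lemma Ck_on_inverse:
  fixes f :: "'a::euclidean_space \<Rightarrow> real"
  assumes "open S" "Ck_on k S f" "\<And>x. x \<in> S \<Longrightarrow> f x \<noteq> 0"
  shows "Ck_on k S (\<lambda>x. inverse (f x))"
  by (rule Ck_on_compose[OF \<open>open S\<close> _ Ck_on_inverse_real assms(2)]) (use assms(3) in \<open>auto simp: open_Compl\<close>)

lemma Ck_on_sqrt_real: "Ck_on k {0<..} sqrt"
proof (induction k)
  case 0 show ?case by (auto intro!: continuous_intros)
next
  case (Suc k)
  show ?case
  proof (rule Ck_on_SucI)
    fix v :: real
    show "Ck_on k {0<..} (\<lambda>x. v * (inverse (sqrt x) / 2))"
      unfolding divide_inverse
      by (intro Ck_on_bilinear[OF _ bounded_bilinear_mult] Ck_on_inverse Suc Ck_on_const) auto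
  next
    fix x :: real assume "x \<in> {0<..}"
    then show "(sqrt has_derivative (\<lambda>v. v * (inverse (sqrt x) / 2))) (at x)"
      using DERIV_real_sqrt[of x] unfolding has_field_derivative_def
      by (auto elim!: has_derivative_eq_rhs)
  qed auto
qed

lemma Ck_on_sqrt:
  assumes "open S" "Ck_on k S f" "\<And>x. x \<in> S \<Longrightarrow> 0 < f x"
  shows "Ck_on k S (\<lambda>x. sqrt (f x))"
  by (rule Ck_on_compose[OF \<open>open S\<close> _ Ck_on_sqrt_real assms(2)]) (use assms(3) in auto)

lemma Ck_on_prod:
  fixes f :: "'i \<Rightarrow> 'a::euclidean_space \<Rightarrow> real"
  assumes "open S" "\<And>i. i \<in> I \<Longrightarrow> Ck_on k S (f i)"
  shows "Ck_on k S (\<lambda>x. \<Prod>i\<in>I. f i x)"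
  using assms(2)
  by (induction I rule: infinite_finite_induct)
    (auto simp: Ck_on_const intro: Ck_on_bilinear[OF \<open>open S\<close> bounded_bilinear_mult])

lemma Ck_on_componentwise:
  fixes f :: "'a::euclidean_space \<Rightarrow> 'b::euclidean_space"
  assumes "open S" "\<And>b. b \<in> Basis \<Longrightarrow> Ck_on k S (\<lambda>x. f x \<bullet> b)"
  shows "Ck_on k S f"
proof (rule Ck_on_cong[OF \<open>open S\<close>])
  show "Ck_on k S (\<lambda>x. \<Sum>b\<in>Basis. (f x \<bullet> b) *\<^sub>R b)"
    by (intro Ck_on_sum Ck_on_bilinear[OF _ bounded_bilinear_scaleR] Ck_on_const assms)
qed (simp add: euclidean_representation)

lemma Ck_on_vec:
  fixes f :: "'a::euclidean_space \<Rightarrow> real ^ 'n::finite"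
  assumes "open S" "\<And>i. Ck_on k S (\<lambda>x. f x $ i)"
  shows "Ck_on k S f"
  by (rule Ck_on_componentwise[OF \<open>open S\<close>])
    (auto simp: Basis_vec_def cart_eq_inner_axis[symmetric] intro: assms)

lemma Ck_on_Pair:
  assumes "open S" "Ck_on k S f" "Ck_on k S g"
  shows "Ck_on k S (\<lambda>x. (f x, g x))"
proof (rule Ck_on_cong[OF \<open>open S\<close>])
  show "Ck_on k S (\<lambda>x. (f x, 0) + (0, g x))"
    by (intro Ck_on_add assms Ck_on_linear[OF _ bounded_linear_Pair[OF bounded_linear_ident bounded_linear_zero]]
      Ck_on_linear[OF _ bounded_linear_Pair[OF bounded_linear_zero bounded_linear_ident]])
qed simp

lemma Ck_on_det:
  fixes A :: "'a::euclidean_space \<Rightarrow> real ^ 'n ^ 'n::finite"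
  assumes "open S" "\<And>i j. Ck_on k S (\<lambda>x. A x $ i $ j)"
  shows "Ck_on k S (\<lambda>x. det (A x))"
  unfolding det_def
  by (intro Ck_on_sum Ck_on_bilinear[OF _ bounded_bilinear_mult] Ck_on_const Ck_on_prod assms)

text \<open>Cramer's rule as a function: it shows that the solution of a linear system is a rational, and
hence smooth, function of the entries.\<close>

definition cramer_solution :: "real ^ 'n ^ 'n::finite \<Rightarrow> real ^ 'n \<Rightarrow> real ^ 'n" where
  "cramer_solution A b = (\<chi> k. det (\<chi> i j. if j = k then b $ i else A $ i $ j) * inverse (det A))"

lemma cramer_solution:
  "det A \<noteq> 0 \<Longrightarrow> A *v x = b \<longleftrightarrow> x = cramer_solution A b"
  by (simp add: cramer cramer_solution_def divide_inverse)

lemma Ck_on_cramer_solution: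
  fixes A :: "'a::euclidean_space \<Rightarrow> real ^ 'n ^ 'n::finite"
  assumes "open S" "\<And>i j. Ck_on k S (\<lambda>x. A x $ i $ j)" "\<And>i. Ck_on k S (\<lambda>x. b x $ i)"
    "\<And>x. x \<in> S \<Longrightarrow> det (A x) \<noteq> 0"
  shows "Ck_on k S (\<lambda>x. cramer_solution (A x) (b x))"
proof (rule Ck_on_vec[OF \<open>open S\<close>])
  fix j
  have "Ck_on k S (\<lambda>x. if l = j then b x $ i else A x $ i $ l)" for i l
    by (cases "l = j") (simp_all add: assms)
  then have *: "Ck_on k S (\<lambda>x. (\<chi> i l. if l = j then b x $ i else A x $ i $ l) $ i $ l)" for i l
    by simp
  then show "Ck_on k S (\<lambda>x. cramer_solution (A x) (b x) $ j)"
    unfolding cramer_solution_def vec_lambda_beta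
    by (intro Ck_on_bilinear[OF _ bounded_bilinear_mult] Ck_on_det Ck_on_inverse assms * )
qed

subsection \<open>Smoothness of all orders\<close>

lemma smooth_on_cong:
  "smooth_on S f \<Longrightarrow> open S \<Longrightarrow> (\<And>x. x \<in> S \<Longrightarrow> f x = g x) \<Longrightarrow> smooth_on S g"
  using Ck_on_cong unfolding smooth_on_def by blast

lemma smooth_on_subset: "smooth_on S f \<Longrightarrow> T \<subseteq> S \<Longrightarrow> smooth_on T f"
  using Ck_on_subset unfolding smooth_on_def by blast

lemma smooth_on_derivative: "smooth_on S f \<Longrightarrow> smooth_on S (\<lambda>x. frechet_derivative f (at x) v)"
  unfolding smooth_on_def by (metis Ck_on.simps(2))

lemma smooth_on_has_derivative:
  "smooth_on S f \<Longrightarrow> open S \<Longrightarrow> x \<in> S \<Longrightarrow> (f has_derivative frechet_derivative f (at x)) (at x)"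
  unfolding smooth_on_def using Ck_on_Suc_has_derivative by blast

lemma smooth_on_imp_continuous: "smooth_on S f \<Longrightarrow> continuous_on S f"
  unfolding smooth_on_def using Ck_on_imp_continuous by blast

lemma smooth_on_compose:
  fixes f :: "'b::euclidean_space \<Rightarrow> 'c::real_normed_vector"
  assumes "open S" "open T" "smooth_on T f" "smooth_on S g" "g ` S \<subseteq> T"
  shows "smooth_on S (\<lambda>x. f (g x))"
  using assms Ck_on_compose unfolding smooth_on_def by blast

lemma smooth_on_const: "smooth_on S (\<lambda>x. c)"
  by (simp add: smooth_on_def Ck_on_const)

lemma smooth_on_id: "open S \<Longrightarrow> smooth_on S (\<lambda>x. x)"
  by (simp add: smooth_on_def Ck_on_id)

lemma smooth_on_linear: "open S \<Longrightarrow> bounded_linear L \<Longrightarrow> smooth_on S f \<Longrightarrow> smooth_on S (\<lambda>x. L (f x))"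
  by (simp add: smooth_on_def Ck_on_linear)

lemma smooth_on_bilinear:
  "open S \<Longrightarrow> bounded_bilinear P \<Longrightarrow> smooth_on S f \<Longrightarrow> smooth_on S g \<Longrightarrow> smooth_on S (\<lambda>x. P (f x) (g x))"
  by (simp add: smooth_on_def Ck_on_bilinear)

lemma smooth_on_add: "open S \<Longrightarrow> smooth_on S f \<Longrightarrow> smooth_on S g \<Longrightarrow> smooth_on S (\<lambda>x. f x + g x)"
  by (simp add: smooth_on_def Ck_on_add)

lemma smooth_on_sum:
  "open S \<Longrightarrow> (\<And>i. i \<in> I \<Longrightarrow> smooth_on S (f i)) \<Longrightarrow> smooth_on S (\<lambda>x. \<Sum>i\<in>I. f i x)"
  by (simp add: smooth_on_def Ck_on_sum)

lemma smooth_on_inverse: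
  fixes f :: "'a::euclidean_space \<Rightarrow> real"
  shows "open S \<Longrightarrow> smooth_on S f \<Longrightarrow> (\<And>x. x \<in> S \<Longrightarrow> f x \<noteq> 0) \<Longrightarrow> smooth_on S (\<lambda>x. inverse (f x))"
  by (simp add: smooth_on_def Ck_on_inverse)

lemma smooth_on_sqrt:
  "open S \<Longrightarrow> smooth_on S f \<Longrightarrow> (\<And>x. x \<in> S \<Longrightarrow> 0 < f x) \<Longrightarrow> smooth_on S (\<lambda>x. sqrt (f x))"
  by (simp add: smooth_on_def Ck_on_sqrt)

lemma smooth_on_Pair: "open S \<Longrightarrow> smooth_on S f \<Longrightarrow> smooth_on S g \<Longrightarrow> smooth_on S (\<lambda>x. (f x, g x))"
  by (simp add: smooth_on_def Ck_on_Pair)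

lemma smooth_on_vec:
  fixes f :: "'a::euclidean_space \<Rightarrow> real ^ 'n::finite"
  shows "open S \<Longrightarrow> (\<And>i. smooth_on S (\<lambda>x. f x $ i)) \<Longrightarrow> smooth_on S f"
  by (simp add: smooth_on_def Ck_on_vec)

lemma smooth_on_cramer_solution:
  fixes A :: "'a::euclidean_space \<Rightarrow> real ^ 'n ^ 'n::finite"
  assumes "open S" "\<And>i j. smooth_on S (\<lambda>x. A x $ i $ j)" "\<And>i. smooth_on S (\<lambda>x. b x $ i)"
    "\<And>x. x \<in> S \<Longrightarrow> det (A x) \<noteq> 0"
  shows "smooth_on S (\<lambda>x. cramer_solution (A x) (b x))"
  using assms by (simp add: smooth_on_def Ck_on_cramer_solution)

section \<open>Symmetry of second derivatives\<close>

lemma has_real_derivative_along_line: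
  fixes f :: "'a::real_normed_vector \<Rightarrow> real"
  assumes "(f has_derivative D) (at (p + s *\<^sub>R u))"
  shows "((\<lambda>s. f (p + s *\<^sub>R u)) has_real_derivative D u) (at s)"
proof -
  have "((\<lambda>s. p + s *\<^sub>R u) has_derivative (\<lambda>h. h *\<^sub>R u)) (at s)"
    by (auto intro!: derivative_eq_intros)
  from has_derivative_compose[OF this assms]
  have "((\<lambda>s. f (p + s *\<^sub>R u)) has_derivative (\<lambda>h. D (h *\<^sub>R u))) (at s)" .
  then show ?thesis
    unfolding has_field_derivative_def
    by (rule has_derivative_eq_rhs)
      (simp add: fun_eq_iff linear_scale[OF has_derivative_linear[OF assms]])
qed

text \<open>The mean value theorem, applied once in each direction, turns a second difference into a second
derivative at a nearby point. The second difference is symmetric in the two directions.\<close>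

lemma second_difference_mean_value:
  fixes f :: "'a::euclidean_space \<Rightarrow> real"
  assumes "open S" "smooth_on S f" "ball x r \<subseteq> S" "0 < h" "h * norm u + h * norm v < r"
  shows "\<exists>\<xi> \<eta>. 0 < \<xi> \<and> \<xi> < h \<and> 0 < \<eta> \<and> \<eta> < h \<and>
    f (x + h *\<^sub>R u + h *\<^sub>R v) - f (x + h *\<^sub>R u) - f (x + h *\<^sub>R v) + f x =
    h * h * frechet_derivative (\<lambda>y. frechet_derivative f (at y) u) (at (x + \<xi> *\<^sub>R u + \<eta> *\<^sub>R v)) v"
proof -
  have inS: "x + a *\<^sub>R u + b *\<^sub>R v \<in> S" if "0 \<le> a" "a \<le> h" "0 \<le> b" "b \<le> h" for a b
  proof -
    have "norm (a *\<^sub>R u + b *\<^sub>R v) \<le> a * norm u + b * norm v"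
      using that norm_triangle_ineq[of "a *\<^sub>R u" "b *\<^sub>R v"] by simp
    also have "\<dots> \<le> h * norm u + h * norm v"
      using that by (intro add_mono mult_right_mono) auto
    finally have "dist (x + a *\<^sub>R u + b *\<^sub>R v) x < r"
      using assms(5) by (simp add: dist_norm add.assoc)
    then show ?thesis using assms(3) by (auto simp: dist_commute)
  qed
  let ?g = "\<lambda>s. f ((x + h *\<^sub>R v) + s *\<^sub>R u) - f (x + s *\<^sub>R u)"
  let ?d = "\<lambda>y. frechet_derivative f (at y) u"
  have "\<exists>\<xi>>0. \<xi> < h \<and> ?g h - ?g 0 = (h - 0) * (?d ((x + h *\<^sub>R v) + \<xi> *\<^sub>R u) - ?d (x + \<xi> *\<^sub>R u))"
  proof (rule MVT2[OF \<open>0 < h\<close>])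
    fix s assume s: "0 \<le> s" "s \<le> h"
    have "(x + h *\<^sub>R v) + s *\<^sub>R u \<in> S" "x + s *\<^sub>R u \<in> S"
      using inS[of s h] inS[of s 0] s \<open>0 < h\<close> by (auto simp: ac_simps)
    then show "(?g has_real_derivative (?d ((x + h *\<^sub>R v) + s *\<^sub>R u) - ?d (x + s *\<^sub>R u))) (at s)"
      by (intro DERIV_diff has_real_derivative_along_line smooth_on_has_derivative[OF assms(2,1)])
  qed
  then obtain \<xi> where \<xi>: "0 < \<xi>" "\<xi> < h"
    "?g h - ?g 0 = h * (?d ((x + h *\<^sub>R v) + \<xi> *\<^sub>R u) - ?d (x + \<xi> *\<^sub>R u))" by auto
  let ?k = "\<lambda>s. ?d ((x + \<xi> *\<^sub>R u) + s *\<^sub>R v)"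
  have "\<exists>\<eta>>0. \<eta> < h \<and> ?k h - ?k 0 = (h - 0) * frechet_derivative ?d (at ((x + \<xi> *\<^sub>R u) + \<eta> *\<^sub>R v)) v"
  proof (rule MVT2[OF \<open>0 < h\<close>])
    fix s assume "0 \<le> s" "s \<le> h"
    then have "(x + \<xi> *\<^sub>R u) + s *\<^sub>R v \<in> S"
      using inS[of \<xi> s] \<xi> by auto
    then show "(?k has_real_derivative frechet_derivative ?d (at ((x + \<xi> *\<^sub>R u) + s *\<^sub>R v)) v) (at s)"
      by (intro has_real_derivative_along_line smooth_on_has_derivative[OF smooth_on_derivative[OF assms(2)] assms(1)])
  qed
  then obtain \<eta> where \<eta>: "0 < \<eta>" "\<eta> < h"
    "?k h - ?k 0 = h * frechet_derivative ?d (at ((x + \<xi> *\<^sub>R u) + \<eta> *\<^sub>R v)) v" by auto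
  have "f (x + h *\<^sub>R u + h *\<^sub>R v) - f (x + h *\<^sub>R u) - f (x + h *\<^sub>R v) + f x = ?g h - ?g 0"
    by (simp add: ac_simps)
  also have "\<dots> = h * (?k h - ?k 0)"
    using \<xi>(3) by (simp add: ac_simps)
  also have "\<dots> = h * h * frechet_derivative ?d (at (x + \<xi> *\<^sub>R u + \<eta> *\<^sub>R v)) v"
    using \<eta>(3) by simp
  finally show ?thesis using \<xi>(1,2) \<eta>(1,2) by blast
qed

text \<open>Letting the step tend to zero in the second difference, continuity of both mixed derivatives
makes them agree.\<close>

lemma second_derivative_symmetric_real:
  fixes f :: "'a::euclidean_space \<Rightarrow> real"
  assumes "open S" "smooth_on S f" "x \<in> S"
  shows "frechet_derivative (\<lambda>y. frechet_derivative f (at y) u) (at x) v =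
         frechet_derivative (\<lambda>y. frechet_derivative f (at y) v) (at x) u" (is "?A x = ?B x")
proof (rule ccontr)
  let ?A = "\<lambda>x. frechet_derivative (\<lambda>y. frechet_derivative f (at y) u) (at x) v"
  let ?B = "\<lambda>x. frechet_derivative (\<lambda>y. frechet_derivative f (at y) v) (at x) u"
  assume "?A x \<noteq> ?B x"
  then have e: "0 < \<bar>?A x - ?B x\<bar> / 2" (is "0 < ?e") by simp
  have cont: "isCont ?A x" "isCont ?B x"
    using smooth_on_imp_continuous[OF smooth_on_derivative[OF smooth_on_derivative[OF assms(2)]]]
      assms(1,3) by (auto simp: continuous_on_eq_continuous_at)
  obtain d1 where d1: "0 < d1" "\<And>z. dist z x < d1 \<Longrightarrow> dist (?A z) (?A x) < ?e"
    using cont(1) e unfolding continuous_at_eps_delta by blast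
  obtain d2 where d2: "0 < d2" "\<And>z. dist z x < d2 \<Longrightarrow> dist (?B z) (?B x) < ?e"
    using cont(2) e unfolding continuous_at_eps_delta by blast
  obtain r0 where r0: "0 < r0" "ball x r0 \<subseteq> S" using assms(1,3) openE by blast
  \<comment> \<open>The step is so small that all intermediate points of both second differences stay in the ball
    where each mixed derivative differs from its value at \<^term>\<open>x\<close> by less than half of the alleged gap.\<close>
  define r where "r = min r0 (min d1 d2)"
  define h where "h = r / (1 + norm u + norm v)"
  have r: "0 < r" "ball x r \<subseteq> S" using r0 d1 d2 by (auto simp: r_def)
  have n: "0 < 1 + norm u + norm v" by (simp add: add_pos_nonneg)
  have h: "0 < h" using r n by (simp add: h_def)
  have "h * (1 + norm u + norm v) = r" using n by (simp add: h_def)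
  then have hr: "h * norm u + h * norm v < r" using h by (simp add: algebra_simps)
  obtain \<xi> \<eta> where 1: "0 < \<xi>" "\<xi> < h" "0 < \<eta>" "\<eta> < h"
    "f (x + h *\<^sub>R u + h *\<^sub>R v) - f (x + h *\<^sub>R u) - f (x + h *\<^sub>R v) + f x = h * h * ?A (x + \<xi> *\<^sub>R u + \<eta> *\<^sub>R v)"
    using second_difference_mean_value[OF assms(1,2) r(2) h hr] by blast
  have hr': "h * norm v + h * norm u < r" using hr by simp
  obtain \<xi>' \<eta>' where 2: "0 < \<xi>'" "\<xi>' < h" "0 < \<eta>'" "\<eta>' < h"
    "f (x + h *\<^sub>R v + h *\<^sub>R u) - f (x + h *\<^sub>R v) - f (x + h *\<^sub>R u) + f x = h * h * ?B (x + \<xi>' *\<^sub>R v + \<eta>' *\<^sub>R u)"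
    using second_difference_mean_value[OF assms(1,2) r(2) h hr'] by blast
  have eq: "?A (x + \<xi> *\<^sub>R u + \<eta> *\<^sub>R v) = ?B (x + \<xi>' *\<^sub>R v + \<eta>' *\<^sub>R u)"
  proof -
    have "h * h * ?A (x + \<xi> *\<^sub>R u + \<eta> *\<^sub>R v) = h * h * ?B (x + \<xi>' *\<^sub>R v + \<eta>' *\<^sub>R u)"
      unfolding 1(5)[symmetric] 2(5)[symmetric] by (simp add: ac_simps)
    then show ?thesis using h by simp
  qed
  have near: "dist (x + a *\<^sub>R p + b *\<^sub>R q) x < r"
    if "0 < a" "a < h" "0 < b" "b < h" "h * norm p + h * norm q < r" for a b p q
  proof -
    have "norm (a *\<^sub>R p + b *\<^sub>R q) \<le> a * norm p + b * norm q"
      using that norm_triangle_ineq[of "a *\<^sub>R p" "b *\<^sub>R q"] by simp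
    also have "\<dots> \<le> h * norm p + h * norm q"
      using that by (intro add_mono mult_right_mono) auto
    finally show ?thesis using that(5) by (simp add: dist_norm add.assoc)
  qed
  have "dist (?A (x + \<xi> *\<^sub>R u + \<eta> *\<^sub>R v)) (?A x) < ?e"
    using near[OF 1(1-4) hr] by (intro d1(2)) (simp add: r_def)
  moreover have "dist (?B (x + \<xi>' *\<^sub>R v + \<eta>' *\<^sub>R u)) (?B x) < ?e"
    using near[OF 2(1-4) hr'] by (intro d2(2)) (simp add: r_def)
  ultimately show False unfolding eq by (simp add: dist_real_def abs_if split: if_splits)
qed

lemma second_derivative_symmetric:
  fixes f :: "'a::euclidean_space \<Rightarrow> 'b::euclidean_space"
  assumes "open S" "smooth_on S f" "x \<in> S"
  shows "frechet_derivative (\<lambda>y. frechet_derivative f (at y) u) (at x) v =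
         frechet_derivative (\<lambda>y. frechet_derivative f (at y) v) (at x) u"
proof (rule euclidean_eqI)
  fix b :: 'b
  have comp: "frechet_derivative (\<lambda>y. g y \<bullet> b) (at y) w = frechet_derivative g (at y) w \<bullet> b"
    if "smooth_on S g" "y \<in> S" for g :: "'a \<Rightarrow> 'b" and y w
    using frechet_derivative_at[OF has_derivative_inner_left[OF smooth_on_has_derivative[OF that(1) assms(1) that(2)]]]
    by metis
  have second: "frechet_derivative (\<lambda>y. frechet_derivative (\<lambda>y. f y \<bullet> b) (at y) u) (at x) v =
      frechet_derivative (\<lambda>y. frechet_derivative f (at y) u) (at x) v \<bullet> b" for u v
  proof -
    have "frechet_derivative (\<lambda>y. frechet_derivative (\<lambda>y. f y \<bullet> b) (at y) u) (at x) =
        frechet_derivative (\<lambda>y. frechet_derivative f (at y) u \<bullet> b) (at x)"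
    proof (rule frechet_derivative_transform_within_open[OF _ assms(1,3)])
      show "(\<lambda>y. frechet_derivative (\<lambda>y. f y \<bullet> b) (at y) u) differentiable at x"
        using smooth_on_has_derivative[OF smooth_on_derivative[OF smooth_on_linear[OF assms(1) bounded_linear_inner_left assms(2)]] assms(1,3)]
        by (auto simp: differentiable_def)
    qed (rule comp[OF assms(2)])
    then show ?thesis using comp[OF smooth_on_derivative[OF assms(2)] assms(3)] by simp
  qed
  show "frechet_derivative (\<lambda>y. frechet_derivative f (at y) u) (at x) v \<bullet> b =
      frechet_derivative (\<lambda>y. frechet_derivative f (at y) v) (at x) u \<bullet> b"
    using second_derivative_symmetric_real[OF assms(1) smooth_on_linear[OF assms(1) bounded_linear_inner_left[of b] assms(2)] assms(3)]
    by (simp add: second)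
qed

section \<open>The inverse function theorem\<close>

text \<open>The derivative of the inverse solves a linear system whose entries are derivatives of \<^term>\<open>f\<close>
composed with \<^term>\<open>g\<close>. By Cramer's rule it is as smooth as \<^term>\<open>g\<close>, which gives one more order for
\<^term>\<open>g\<close> itself.\<close>

lemma Ck_on_inverse_function:
  fixes f g :: "real ^ 'n::finite \<Rightarrow> real ^ 'n"
  assumes "open U" "open V" "smooth_on U f" "g ` V \<subseteq> U"
    and g': "\<And>y. y \<in> V \<Longrightarrow> (g has_derivative g' y) (at y)"
    and right: "\<And>y v. y \<in> V \<Longrightarrow> frechet_derivative f (at (g y)) (g' y v) = v"
  shows "Ck_on k V g"
proof (induction k)
  case 0
  show ?case using g' by (auto intro!: continuous_at_imp_continuous_on has_derivative_continuous)
next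
  case (Suc k)
  define J where "J y = matrix (frechet_derivative f (at (g y)))" for y
  have lin: "linear (frechet_derivative f (at (g y)))" if "y \<in> V" for y
    using smooth_on_has_derivative[OF assms(3,1)] assms(4) that
    by (intro has_derivative_linear[of f]) auto
  have det: "det (J y) \<noteq> 0" if "y \<in> V" for y
  proof -
    have "J y ** matrix (g' y) = matrix (frechet_derivative f (at (g y)) \<circ> g' y)"
      unfolding J_def using lin[OF that] has_derivative_linear[OF g'[OF that]]
      by (simp add: matrix_compose)
    also have "frechet_derivative f (at (g y)) \<circ> g' y = id"
      using right[OF that] by (simp add: fun_eq_iff)
    finally show ?thesis
      unfolding invertible_det_nz[symmetric] invertible_right_inverse
      by (metis matrix_id_mat_1)
  qed
  show ?case
  proof (rule Ck_on_SucI[OF \<open>open V\<close> g'])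
    fix v
    show "Ck_on k V (\<lambda>y. g' y v)"
    proof (rule Ck_on_cong[OF \<open>open V\<close>])
      show "Ck_on k V (\<lambda>y. cramer_solution (J y) v)"
      proof (rule Ck_on_cramer_solution[OF \<open>open V\<close> _ Ck_on_const det])
        fix i j
        have "Ck_on k V (\<lambda>y. frechet_derivative f (at (g y)) (axis j 1))"
        proof (rule Ck_on_compose[OF \<open>open V\<close> \<open>open U\<close> _ Suc assms(4)])
          show "Ck_on k U (\<lambda>x. frechet_derivative f (at x) (axis j 1))"
            using smooth_on_derivative[OF assms(3)] unfolding smooth_on_def by blast
        qed
        then show "Ck_on k V (\<lambda>y. J y $ i $ j)"
          using Ck_on_linear[OF \<open>open V\<close> bounded_linear_vec_nth]
          by (auto simp: J_def matrix_def)
      qed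
      show "cramer_solution (J y) v = g' y v" if "y \<in> V" for y
        using cramer_solution[OF det[OF that], of "g' y v" v] right[OF that] lin[OF that]
        by (simp add: J_def matrix_works)
    qed
  qed
qed

text \<open>The inverse function theorem with a smooth inverse, between two Euclidean spaces of the same
dimension that may be of different type.\<close>

lemma smooth_local_inverse:
  fixes f :: "real ^ 'n::finite \<Rightarrow> 'b::euclidean_space"
  assumes "open S" "x0 \<in> S" "smooth_on S f" "DIM('b) = CARD('n)"
    and inj: "inj (frechet_derivative f (at x0))"
  obtains U V g where "open U" "U \<subseteq> S" "x0 \<in> U" "open V" "homeomorphism U V f g" "smooth_on V g"
proof -
  obtain \<iota> :: "'b \<Rightarrow> real ^ 'n" and \<iota>' where \<iota>: "linear \<iota>" "linear \<iota>'" "\<And>x. \<iota>' (\<iota> x) = x" "\<And>y. \<iota> (\<iota>' y) = y"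
  proof -
    have "DIM('b) = DIM(real ^ 'n)" using assms(4) by simp
    then show ?thesis
      using isomorphisms_UNIV_UNIV[where ?'M='b and ?'N="real^'n"] that by metis
  qed
  have bl: "bounded_linear \<iota>" "bounded_linear \<iota>'"
    using \<iota> by (simp_all add: linear_conv_bounded_linear)
  let ?F = "\<lambda>x. \<iota> (f x)"
  define D where "D x = Blinfun (\<lambda>v. \<iota> (frechet_derivative f (at x) v))" for x
  have F: "smooth_on S ?F" by (rule smooth_on_linear[OF assms(1) bl(1) assms(3)])
  have dF: "(?F has_derivative (\<lambda>v. \<iota> (frechet_derivative f (at x) v))) (at x)" if "x \<in> S" for x
    by (rule bounded_linear.has_derivative[OF bl(1) smooth_on_has_derivative[OF assms(3,1) that]])
  have D: "blinfun_apply (D x) = (\<lambda>v. \<iota> (frechet_derivative f (at x) v))" if "x \<in> S" for x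
    unfolding D_def by (rule bounded_linear_Blinfun_apply[OF has_derivative_bounded_linear[OF dF[OF that]]])
  have fF: "frechet_derivative ?F (at x) = blinfun_apply (D x)" if "x \<in> S" for x
    using frechet_derivative_at[OF dF[OF that]] D[OF that] by simp
  have dF': "(?F has_derivative blinfun_apply (D x)) (at x)" if "x \<in> S" for x
    using dF[OF that] D[OF that] by simp
  have contD: "continuous_on S D"
  proof (rule continuous_on_blinfun_componentwise)
    fix b :: "real ^ 'n" 
    show "continuous_on S (\<lambda>x. D x b)"
      using smooth_on_imp_continuous[OF smooth_on_derivative[OF F, of b]] fF
      by (simp cong: continuous_on_cong)
  qed
  have "inj (D x0)"
    using inj \<iota>(3) unfolding D[OF assms(2)] inj_def by metis
  then obtain G where G: "linear G" "G \<circ> blinfun_apply (D x0) = id"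
    using linear_injective_left_inverse[OF has_derivative_linear[OF dF'[OF assms(2)]]] by blast
  have "Blinfun G o\<^sub>L D x0 = id_blinfun"
    using G by (intro blinfun_eqI) (simp add: bounded_linear_Blinfun_apply linear_conv_bounded_linear fun_eq_iff)
  from inverse_function_theorem[OF assms(1) dF' contD assms(2) this]
  obtain U V g g' where U: "open U" "U \<subseteq> S" "x0 \<in> U" and V: "open V" and hom: "homeomorphism U V ?F g"
    and g': "\<And>y. y \<in> V \<Longrightarrow> (g has_derivative (g' y)) (at y)"
       "\<And>y. y \<in> V \<Longrightarrow> g' y = inv (blinfun_apply (D (g y)))"
       "\<And>y. y \<in> V \<Longrightarrow> bij (blinfun_apply (D (g y)))"
    by metis
  have gV: "g ` V = U" and FU: "?F ` U = V" using hom by (auto simp: homeomorphism_def)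
  have smg: "smooth_on V g"
    unfolding smooth_on_def
  proof
    fix k show "Ck_on k V g"
    proof (rule Ck_on_inverse_function[OF U(1) V smooth_on_subset[OF F U(2)] _ g'(1)])
      show "frechet_derivative ?F (at (g y)) (g' y v) = v" if "y \<in> V" for y v
        using g'(2,3)[OF that] gV that U(2) by (subst fF) (auto simp: bij_is_surj surj_f_inv_f)
    qed (use gV in auto)
  qed
  let ?W = "\<iota> -` V"
  have W: "open ?W"
    using continuous_open_vimage[OF V] linear_continuous_at[OF bl(1)] by blast
  show ?thesis
  proof
    show "homeomorphism U ?W f (\<lambda>y. g (\<iota> y))"
    proof (rule homeomorphismI)
      show "continuous_on U f"
        using smooth_on_imp_continuous[OF smooth_on_subset[OF assms(3) U(2)]] .
      have "continuous_on V g" using hom by (auto simp: homeomorphism_def)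
      then show "continuous_on ?W (\<lambda>y. g (\<iota> y))"
        by (rule continuous_on_compose2[OF _ linear_continuous_on[OF bl(1)]]) auto
      show "f ` U \<subseteq> ?W" using FU by auto
      show "(\<lambda>y. g (\<iota> y)) ` ?W \<subseteq> U" using gV by auto
      show "g (\<iota> (f x)) = x" if "x \<in> U" for x
        using hom that by (auto simp: homeomorphism_def)
      show "f (g (\<iota> y)) = y" if "y \<in> ?W" for y
      proof -
        have "\<iota> (f (g (\<iota> y))) = \<iota> y" using hom that by (auto simp: homeomorphism_def)
        then show ?thesis by (metis \<iota>(3))
      qed
    qed
    show "smooth_on ?W (\<lambda>y. g (\<iota> y))"
    proof (rule smooth_on_compose[OF W V smg])
      show "smooth_on ?W \<iota>"
        unfolding smooth_on_def using Ck_on_linear[OF W bl(1) Ck_on_id[OF W]] by blast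
    qed auto
  qed (use U W in auto)
qed

section \<open>Linear algebra of the Minkowski form\<close>

text \<open>The Minkowski form is the inner product preceded by this map. That makes it a bounded bilinear map
and shows that it is nondegenerate.\<close>

definition time_reversal :: "'n::finite minkowski \<Rightarrow> 'n minkowski" where
  "time_reversal u = (- fst u, snd u)"

lemma mink_inner_time_reversal: "mink u v = time_reversal u \<bullet> v"
  by (cases u; cases v) (simp add: time_reversal_def inner_vec_def)

lemma bounded_linear_time_reversal: "bounded_linear time_reversal"
  unfolding time_reversal_def
  by (intro bounded_linear_Pair bounded_linear_minus bounded_linear_fst bounded_linear_snd)

lemma bounded_bilinear_mink: "bounded_bilinear (mink :: 'n::finite minkowski \<Rightarrow> 'n minkowski \<Rightarrow> real)"
  using bounded_bilinear.comp[OF bounded_bilinear_inner bounded_linear_time_reversal bounded_linear_ident]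
  by (simp add: mink_inner_time_reversal[abs_def])

interpretation mink: bounded_bilinear "mink :: 'n::finite minkowski \<Rightarrow> 'n minkowski \<Rightarrow> real"
  by (rule bounded_bilinear_mink)

lemma mink_eq: "mink u v = - (fst u * fst v) + fst (snd u) \<bullet> fst (snd v) + snd (snd u) * snd (snd v)"
  by (cases u; cases v) (simp add: inner_vec_def)

lemma mink_commute: "mink u v = mink v u"
  by (simp add: mink_eq inner_commute mult.commute)

lemma mink_nondegenerate: "(\<And>v. mink v w = 0) \<Longrightarrow> w = 0"
proof -
  assume "\<And>v. mink v w = 0"
  from this[of "time_reversal w"] show "w = 0"
    by (simp add: mink_inner_time_reversal time_reversal_def)
qed

abbreviation vertical :: "'n::finite minkowski" where "vertical \<equiv> (0, 0, 1)"

lemma mink_vertical [simp]: "mink u vertical = snd (snd u)" "mink vertical u = snd (snd u)"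
  by (simp_all add: mink_eq)

text \<open>The differential of a Riemannian immersion: its image is an \<open>n\<close>-dimensional tangent space on which
the Minkowski form is positive definite.\<close>

definition spacelike :: "(real ^ 'n::finite \<Rightarrow> 'n minkowski) \<Rightarrow> bool" where
  "spacelike D \<longleftrightarrow> linear D \<and> (\<forall>v. v \<noteq> 0 \<longrightarrow> 0 < mink (D v) (D v))"

lemma spacelike_linear: "spacelike D \<Longrightarrow> linear D" by (simp add: spacelike_def)

lemma spacelike_eq_0: "spacelike D \<Longrightarrow> mink (D v) (D v) = 0 \<Longrightarrow> v = 0"
  by (metis less_irrefl spacelike_def)

lemma spacelike_inj: "spacelike D \<Longrightarrow> inj D"
  by (metis linear_injective_0 mink.zero_left spacelike_eq_0 spacelike_linear)

text \<open>The tangent space, \<open>\<theta>\<close> and a normal vector orthogonal to \<open>\<theta>\<close> are all orthogonal to \<open>\<theta>\<close>. If that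
vector were not in the span of the others, they would together span the whole space, by a count of
dimensions, and then \<open>\<theta>\<close> would be orthogonal to everything. So it is in the span, and being normal it has
no tangential part.\<close>

lemma normal_orthogonal_null_line:
  fixes D :: "real ^ 'n::finite \<Rightarrow> 'n minkowski"
  assumes D: "spacelike D" and \<theta>: "\<theta> \<noteq> 0" "mink \<theta> \<theta> = 0" "\<And>v. mink (D v) \<theta> = 0"
    and w: "\<And>v. mink (D v) w = 0" "mink w \<theta> = 0"
  shows "\<exists>a. w = a *\<^sub>R \<theta>"
proof -
  let ?T = "range D"
  have sub: "subspace ?T" using D by (simp add: linear_subspace_image spacelike_linear)
  have not_in: "\<theta> \<notin> ?T"
  proof
    assume "\<theta> \<in> ?T"
    then obtain v where v: "\<theta> = D v" by blast
    then have "v = 0" using \<theta>(2) spacelike_eq_0[OF D] by simp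
    then show False using v \<theta>(1) linear_0[OF spacelike_linear[OF D]] by simp
  qed
  have "dim ?T = CARD('n)"
    using dim_image_eq[OF spacelike_linear[OF D], of UNIV] spacelike_inj[OF D] by simp
  then have dim1: "dim (insert \<theta> ?T) = CARD('n) + 1"
    using not_in sub by (simp add: dim_insert span_eq_iff[THEN iffD2])
  have "w \<in> span (insert \<theta> ?T)"
  proof (rule ccontr)
    assume "w \<notin> span (insert \<theta> ?T)"
    then have "dim (insert w (insert \<theta> ?T)) = DIM('n minkowski)"
      using dim1 by (simp only: dim_insert) simp
    then have full: "span (insert w (insert \<theta> ?T)) = UNIV"
      by (simp only: dim_eq_full)
    have "mink x \<theta> = 0" for x
    proof (rule span_induct[of x "insert w (insert \<theta> ?T)"])
      show "x \<in> span (insert w (insert \<theta> ?T))" using full by blast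
      show "subspace {x. mink x \<theta> = 0}"
        by (auto simp: subspace_def mink.add_left mink.scaleR_left mink.zero_left)
    qed (use \<theta> w in auto)
    then show False using mink_nondegenerate \<theta>(1) by blast
  qed
  then obtain k where "w - k *\<^sub>R \<theta> \<in> span ?T" using span_breakdown_eq by blast
  then obtain v where v: "w - k *\<^sub>R \<theta> = D v" using sub by (auto simp: span_eq_iff[THEN iffD2])
  have "mink (D v) (D v) = 0"
    using w(1)[of v] \<theta>(3)[of v] by (simp add: v[symmetric] mink.diff_right mink.scaleR_right)
  then have "D v = 0" using spacelike_eq_0[OF D] linear_0[OF spacelike_linear[OF D]] by blast
  then show ?thesis using v by auto
qed

text \<open>A suitable multiple of \<open>N\<close> makes a normal vector orthogonal to \<open>\<theta>\<close>; so \<open>\<theta>\<close> and \<open>N\<close> span the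
normal plane.\<close>

lemma normal_null_frame:
  assumes D: "spacelike D" and \<theta>: "\<theta> \<noteq> 0" "mink \<theta> \<theta> = 0" "\<And>v. mink (D v) \<theta> = 0"
    and N: "\<And>v. mink (D v) N = 0" "mink N \<theta> \<noteq> 0"
    and w: "\<And>v. mink (D v) w = 0"
  shows "\<exists>a b. w = a *\<^sub>R \<theta> + b *\<^sub>R N"
proof -
  let ?b = "mink w \<theta> / mink N \<theta>"
  have "\<exists>a. w - ?b *\<^sub>R N = a *\<^sub>R \<theta>"
    using N w by (intro normal_orthogonal_null_line[OF D \<theta>])
      (simp_all add: mink.diff_left mink.diff_right mink.scaleR_left mink.scaleR_right)
  then obtain a where "w - ?b *\<^sub>R N = a *\<^sub>R \<theta>" by blast
  then have "w = a *\<^sub>R \<theta> + ?b *\<^sub>R N" by (simp add: algebra_simps)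
  then show ?thesis by blast
qed

definition gram :: "(real ^ 'n::finite \<Rightarrow> 'n minkowski) \<Rightarrow> real ^ 'n ^ 'n" where
  "gram D = (\<chi> i j. mink (D (axis i 1)) (D (axis j 1)))"

text \<open>The coordinates of the orthogonal projection of \<^term>\<open>w\<close> to the tangent space, by inverting the Gram
matrix. This formula shows that the projection depends smoothly on the point.\<close>

definition tangent_coords :: "(real ^ 'n::finite \<Rightarrow> 'n minkowski) \<Rightarrow> 'n minkowski \<Rightarrow> real ^ 'n" where
  "tangent_coords D w = cramer_solution (gram D) (\<chi> i. mink (D (axis i 1)) w)"

lemma linear_axis_expansion:
  fixes D :: "real ^ 'n::finite \<Rightarrow> 'b::real_vector"
  assumes "linear D"
  shows "D c = (\<Sum>i\<in>UNIV. (c $ i) *\<^sub>R D (axis i 1))"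
proof -
  have "c = (\<Sum>i\<in>UNIV. (c $ i) *\<^sub>R axis i 1)"
    using basis_expansion[of c] by (simp add: scalar_mult_eq_scaleR)
  then have "D c = D (\<Sum>i\<in>UNIV. (c $ i) *\<^sub>R axis i 1)" by simp
  then show ?thesis by (simp add: linear_sum[OF assms] linear_scale[OF assms])
qed

lemma gram_mult:
  assumes "linear D"
  shows "(gram D *v c) $ i = mink (D (axis i 1)) (D c)"
  by (subst linear_axis_expansion[OF assms, of c])
    (simp add: gram_def matrix_vector_mult_def mink.sum_right mink.scaleR_right mult.commute)

lemma det_gram:
  assumes "spacelike D" shows "det (gram D) \<noteq> 0"
proof -
  have "c = 0" if "gram D *v c = 0" for c
  proof (rule spacelike_eq_0[OF assms])
    have "mink (D (axis i 1)) (D c) = 0" for i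
      using gram_mult[OF spacelike_linear[OF assms], of c i] that by simp
    then show "mink (D c) (D c) = 0"
      by (subst linear_axis_expansion[OF spacelike_linear[OF assms], of c])
        (simp add: mink.sum_left mink.scaleR_left)
  qed
  then show ?thesis
    unfolding invertible_det_nz[symmetric] invertible_left_inverse matrix_left_invertible_ker by blast
qed

lemma tangent_coords_normal:
  assumes "spacelike D"
  shows "mink (D v) (w - D (tangent_coords D w)) = 0"
proof -
  have "gram D *v tangent_coords D w = (\<chi> i. mink (D (axis i 1)) w)"
    unfolding tangent_coords_def using cramer_solution[OF det_gram[OF assms]] by blast
  then have "mink (D (axis i 1)) (w - D (tangent_coords D w)) = 0" for i
    using gram_mult[OF spacelike_linear[OF assms], of "tangent_coords D w" i]
    by (simp add: mink.diff_right)
  then show ?thesis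
    by (subst linear_axis_expansion[OF spacelike_linear[OF assms], of v])
      (simp add: mink.sum_left mink.scaleR_left)
qed

lemma tangent_coords_unique:
  assumes "spacelike D" "\<And>v. mink (D v) (w - D c) = 0"
  shows "c = tangent_coords D w"
proof -
  have "mink (D (c - tangent_coords D w)) (D (c - tangent_coords D w)) =
      mink (D (c - tangent_coords D w)) (w - D (tangent_coords D w)) -
      mink (D (c - tangent_coords D w)) (w - D c)"
    by (simp add: linear_diff[OF spacelike_linear[OF assms(1)]] mink.diff_left mink.diff_right)
  also have "\<dots> = 0" by (simp only: tangent_coords_normal[OF assms(1)] assms(2))
  finally have "c - tangent_coords D w = 0" using spacelike_eq_0[OF assms(1)] by blast
  then show ?thesis by simp
qed

text \<open>The light-like normal field \<open>\<theta>\<close> as a linear function of the position vector.\<close>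

definition horizontal :: "'n::finite minkowski \<Rightarrow> 'n minkowski" where
  "horizontal x = (fst x, fst (snd x), 0)"

lemma theta_field_eq: "theta_field \<phi> p = horizontal (\<phi> p)"
  by (simp add: theta_field_def horizontal_def split: prod.split)

lemma horizontal_alt: "horizontal x = x - snd (snd x) *\<^sub>R vertical"
  by (simp add: horizontal_def prod_eq_iff)

lemma linear_horizontal: "bounded_linear horizontal"
  unfolding horizontal_def
  by (intro bounded_linear_Pair bounded_linear_fst bounded_linear_zero
    bounded_linear_fst_comp bounded_linear_snd)

lemma light_cone_cylinder_iff:
  "x \<in> light_cone_cylinder \<longleftrightarrow> 0 < fst x \<and> norm (fst (snd x)) = fst x"
proof -
  obtain a y b where x: "x = (a, y, b)" by (cases x)
  have "(\<Sum>i\<in>UNIV. (y $ i)\<^sup>2) = (norm y)\<^sup>2"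
    by (simp only: power2_norm_eq_inner) (simp add: inner_vec_def power2_eq_square)
  then have "x \<in> light_cone_cylinder \<longleftrightarrow> (norm y)\<^sup>2 = a\<^sup>2 \<and> 0 < a"
    by (auto simp: x light_cone_cylinder_def)
  then show ?thesis using x power2_eq_iff_nonneg[of "norm y" a] by auto
qed

lemma horizontal_null:
  assumes "x \<in> light_cone_cylinder"
  shows "horizontal x \<noteq> 0" "mink (horizontal x) (horizontal x) = 0"
  using assms unfolding light_cone_cylinder_iff
  by (auto simp: horizontal_def mink_eq prod_eq_iff power2_norm_eq_inner[symmetric] power2_eq_square[symmetric])

text \<open>The normal part of \<open>\<partial>\<close> is orthogonal to \<open>\<theta>\<close>, hence a multiple of \<open>\<theta>\<close>. Since this is light-like,
the tangential part \<open>e\<^sub>1\<close> has the same length as \<open>\<partial>\<close>.\<close>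

lemma vertical_decomposition:
  assumes D: "spacelike D" and x: "x \<in> light_cone_cylinder" "\<And>v. mink (D v) (horizontal x) = 0"
  obtains k where "vertical - D (tangent_coords D vertical) = k *\<^sub>R horizontal x"
    "mink (D (tangent_coords D vertical)) (D (tangent_coords D vertical)) = 1"
proof -
  let ?e = "D (tangent_coords D vertical)"
  have "\<exists>k. vertical - ?e = k *\<^sub>R horizontal x"
  proof (rule normal_orthogonal_null_line[OF D horizontal_null[OF x(1)] x(2)])
    show "mink (vertical - ?e) (horizontal x) = 0"
      using x(2) by (simp add: mink.diff_left horizontal_def)
  qed (rule tangent_coords_normal[OF D])
  then obtain k where k: "vertical - ?e = k *\<^sub>R horizontal x" by blast
  have v: "vertical = ?e + k *\<^sub>R horizontal x" using k by (simp add: algebra_simps)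
  have "(1::real) = mink (vertical :: 'a minkowski) vertical" by simp
  also have "\<dots> = mink (?e + k *\<^sub>R horizontal x) (?e + k *\<^sub>R horizontal x)"
    using v by simp
  also have "\<dots> = mink ?e ?e"
    using x(2) horizontal_null[OF x(1)]
    by (simp add: mink.add_left mink.add_right mink.scaleR_left mink.scaleR_right mink_commute[of "horizontal x" ?e])
  finally show ?thesis using that[OF k] by simp
qed

section \<open>Isotropic immersions into the cylinder\<close>

definition second_derivative :: "('a::euclidean_space \<Rightarrow> 'b::real_normed_vector) \<Rightarrow> 'a \<Rightarrow> 'a \<Rightarrow> 'a \<Rightarrow> 'b" where
  "second_derivative f x u v = frechet_derivative (\<lambda>y. frechet_derivative f (at y) u) (at x) v"

text \<open>The value of the second fundamental form at \<open>x\<close> on the pair \<open>(u, u)\<close>, for a vector \<open>u\<close> of arbitrary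
length in the coordinates of a chart.\<close>

definition normal_curvature :: "(real ^ 'n::finite \<Rightarrow> 'n minkowski) \<Rightarrow> real ^ 'n \<Rightarrow> real ^ 'n \<Rightarrow> 'n minkowski" where
  "normal_curvature f x u = second_derivative f x u u -
     frechet_derivative f (at x) (tangent_coords (frechet_derivative f (at x)) (second_derivative f x u u))"

text \<open>The local picture: an immersion \<^term>\<open>f\<close> of an open set into the cylinder, such as the position
vector of the submanifold read in a chart.\<close>

locale cone_immersion =
  fixes f :: "real ^ 'n::finite \<Rightarrow> 'n minkowski" and \<Omega> :: "(real ^ 'n) set"
  assumes open_domain: "open \<Omega>" and smooth: "smooth_on \<Omega> f"
    and spacelike: "\<And>x. x \<in> \<Omega> \<Longrightarrow> spacelike (frechet_derivative f (at x))"
    and on_cone: "\<And>x. x \<in> \<Omega> \<Longrightarrow> f x \<in> light_cone_cylinder"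
begin

abbreviation d :: "real ^ 'n \<Rightarrow> real ^ 'n \<Rightarrow> 'n minkowski" where
  "d x \<equiv> frechet_derivative f (at x)"

abbreviation \<theta> :: "real ^ 'n \<Rightarrow> 'n minkowski" where
  "\<theta> x \<equiv> horizontal (f x)"

lemma f_has_derivative: "x \<in> \<Omega> \<Longrightarrow> (f has_derivative d x) (at x)"
  using smooth_on_has_derivative[OF smooth open_domain] .

lemma linear_d: "x \<in> \<Omega> \<Longrightarrow> linear (d x)"
  using spacelike spacelike_linear by blast

lemma d_has_derivative: "x \<in> \<Omega> \<Longrightarrow> ((\<lambda>y. d y u) has_derivative second_derivative f x u) (at x)"
  using smooth_on_has_derivative[OF smooth_on_derivative[OF smooth] open_domain]
  by (simp add: second_derivative_def[abs_def])

lemma smooth_d: "smooth_on \<Omega> (\<lambda>y. d y u)"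
  by (rule smooth_on_derivative[OF smooth])

lemma smooth_dd: "smooth_on \<Omega> (\<lambda>y. second_derivative f y u v)"
  unfolding second_derivative_def by (rule smooth_on_derivative[OF smooth_d])

lemma second_derivative_sym: "x \<in> \<Omega> \<Longrightarrow> second_derivative f x u v = second_derivative f x v u"
  unfolding second_derivative_def by (rule second_derivative_symmetric[OF open_domain smooth])

lemma second_derivative_linear: "x \<in> \<Omega> \<Longrightarrow> linear (second_derivative f x u)"
  using d_has_derivative has_derivative_linear by blast

lemma second_derivative_add_right: "x \<in> \<Omega> \<Longrightarrow> second_derivative f x u (v + w) = second_derivative f x u v + second_derivative f x u w"
  using second_derivative_linear linear_add by blast

lemma second_derivative_add_left: "x \<in> \<Omega> \<Longrightarrow> second_derivative f x (v + w) u = second_derivative f x v u + second_derivative f x w u"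
  using second_derivative_add_right second_derivative_sym by metis

lemma second_derivative_diff_right: "x \<in> \<Omega> \<Longrightarrow> second_derivative f x u (v - w) = second_derivative f x u v - second_derivative f x u w"
  using second_derivative_linear linear_diff by blast

lemma second_derivative_diff_left: "x \<in> \<Omega> \<Longrightarrow> second_derivative f x (v - w) u = second_derivative f x v u - second_derivative f x w u"
  using second_derivative_diff_right second_derivative_sym by metis

lemma d_normal_\<theta>:
  assumes "x \<in> \<Omega>" shows "mink (d x v) (\<theta> x) = 0"
proof -
  have dt: "(\<theta> has_derivative (\<lambda>v. horizontal (d x v))) (at x)"
    by (rule bounded_linear.has_derivative[OF linear_horizontal f_has_derivative[OF assms]])
  have 1: "((\<lambda>y. mink (\<theta> y) (\<theta> y)) has_derivative
      (\<lambda>v. mink (\<theta> x) (horizontal (d x v)) + mink (horizontal (d x v)) (\<theta> x))) (at x)"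
    by (rule mink.FDERIV[OF dt dt])
  have 2: "((\<lambda>y. mink (\<theta> y) (\<theta> y)) has_derivative (\<lambda>v. 0)) (at x)"
  proof (rule has_derivative_transform_within_open[OF _ open_domain assms])
    show "((\<lambda>y. 0) has_derivative (\<lambda>v. 0)) (at x)" by simp
  qed (simp add: horizontal_null(2)[OF on_cone])
  have "mink (horizontal (d x v)) (\<theta> x) = 0"
    using fun_cong[OF has_derivative_unique[OF 1 2], of v] by (simp add: mink_commute)
  then show ?thesis by (simp add: mink_eq horizontal_def)
qed

text \<open>Differentiate \<open>\<langle>f\<^sub>u, \<theta>\<rangle> = 0\<close>, using that the derivative of \<open>\<theta>\<close> is the horizontal part of that of
\<^term>\<open>f\<close>.\<close>

lemma second_derivative_\<theta>:
  assumes "x \<in> \<Omega>"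
  shows "mink (second_derivative f x u v) (\<theta> x) =
    - (mink (d x u) (d x v) - snd (snd (d x u)) * snd (snd (d x v)))"
proof -
  have dt: "(\<theta> has_derivative (\<lambda>v. horizontal (d x v))) (at x)"
    by (rule bounded_linear.has_derivative[OF linear_horizontal f_has_derivative[OF assms]])
  have 1: "((\<lambda>y. mink (d y u) (\<theta> y)) has_derivative
      (\<lambda>v. mink (d x u) (horizontal (d x v)) + mink (second_derivative f x u v) (\<theta> x))) (at x)"
    by (rule mink.FDERIV[OF d_has_derivative[OF assms] dt])
  have 2: "((\<lambda>y. mink (d y u) (\<theta> y)) has_derivative (\<lambda>v. 0)) (at x)"
  proof (rule has_derivative_transform_within_open[OF _ open_domain assms])
    show "((\<lambda>y. 0) has_derivative (\<lambda>v. 0)) (at x)" by simp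
  qed (use d_normal_\<theta> in auto)
  have "mink (d x u) (horizontal (d x v)) + mink (second_derivative f x u v) (\<theta> x) = 0"
    using fun_cong[OF has_derivative_unique[OF 1 2], of v] by simp
  then show ?thesis by (simp add: mink_eq horizontal_def)
qed

abbreviation E :: "real ^ 'n \<Rightarrow> real ^ 'n" where
  "E x \<equiv> tangent_coords (d x) vertical"

lemma mink_d_E: "x \<in> \<Omega> \<Longrightarrow> mink (d x v) (d x (E x)) = snd (snd (d x v))"
  using tangent_coords_normal[OF spacelike, of x v vertical]
  by (simp add: mink.diff_right)

lemma unit_E: "x \<in> \<Omega> \<Longrightarrow> mink (d x (E x)) (d x (E x)) = 1"
  by (rule vertical_decomposition[OF spacelike on_cone d_normal_\<theta>])

lemma normal_curvature_normal: "x \<in> \<Omega> \<Longrightarrow> mink (d x v) (normal_curvature f x u) = 0"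
  unfolding normal_curvature_def by (rule tangent_coords_normal[OF spacelike])

lemma normal_curvature_pair:
  assumes "x \<in> \<Omega>" "\<And>v. mink (d x v) N = 0"
  shows "mink (normal_curvature f x u) N = mink (second_derivative f x u u) N"
  using assms(2) by (simp add: normal_curvature_def mink.diff_left)

text \<open>\<^term>\<open>E x\<close> represents \<open>e\<^sub>1\<close>, for which the \<open>\<theta>\<close>-component of the second fundamental form vanishes.\<close>

lemma normal_curvature_E_null:
  assumes "x \<in> \<Omega>"
  shows "mink (normal_curvature f x (E x)) (normal_curvature f x (E x)) = 0"
proof -
  have "mink (normal_curvature f x (E x)) (\<theta> x) = 0"
    using mink_d_E[OF assms, of "E x"] unit_E[OF assms]
    by (simp add: normal_curvature_pair[OF assms d_normal_\<theta>[OF assms]] second_derivative_\<theta>[OF assms])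
  then obtain a where "normal_curvature f x (E x) = a *\<^sub>R \<theta> x"
    using normal_orthogonal_null_line[OF spacelike[OF assms] horizontal_null[OF on_cone[OF assms]]
        d_normal_\<theta>[OF assms] normal_curvature_normal[OF assms]] by blast
  then show ?thesis
    using horizontal_null(2)[OF on_cone[OF assms]] by (simp add: mink.scaleR_left mink.scaleR_right)
qed

text \<open>The squared length of the component of the tangent vector \<^term>\<open>d x u\<close> orthogonal to \<open>e\<^sub>1\<close>. Up to sign
it is the \<open>\<theta>\<close>-component of the second fundamental form on \<open>(u, u)\<close>.\<close>

definition slant :: "real ^ 'n \<Rightarrow> real ^ 'n \<Rightarrow> real" where
  "slant x u = mink (d x u) (d x u) - (snd (snd (d x u)))\<^sup>2"

lemma normal_curvature_\<theta>: "x \<in> \<Omega> \<Longrightarrow> mink (normal_curvature f x u) (\<theta> x) = - slant x u"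
  by (simp add: normal_curvature_pair d_normal_\<theta> second_derivative_\<theta> slant_def power2_eq_square)

lemma slant_eq_0_imp:
  assumes "x \<in> \<Omega>" "slant x u = 0"
  shows "u = snd (snd (d x u)) *\<^sub>R E x"
proof -
  let ?c = "snd (snd (d x u))"
  have "mink (d x (u - ?c *\<^sub>R E x)) (d x (u - ?c *\<^sub>R E x)) =
      mink (d x u) (d x u) - 2 * ?c * mink (d x u) (d x (E x)) + ?c * ?c * mink (d x (E x)) (d x (E x))"
    by (simp add: linear_diff[OF linear_d[OF assms(1)]] linear_scale[OF linear_d[OF assms(1)]]
      mink.diff_left mink.diff_right mink.scaleR_left mink.scaleR_right
      mink_commute[of "d x (E x)" "d x u"] algebra_simps)
  also have "\<dots> = slant x u"
    unfolding unit_E[OF assms(1)] mink_d_E[OF assms(1), of u] by (simp add: slant_def power2_eq_square)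
  finally have "mink (d x (u - ?c *\<^sub>R E x)) (d x (u - ?c *\<^sub>R E x)) = slant x u" .
  then have "u - ?c *\<^sub>R E x = 0"
    unfolding assms(2) by (rule spacelike_eq_0[OF spacelike[OF assms(1)]])
  then show ?thesis by simp
qed

text \<open>Here \<open>v\<close> is a multiple of \<^term>\<open>E x\<close>, which does not affect the component orthogonal to \<open>e\<^sub>1\<close>.\<close>

lemma slant_add_diff:
  assumes "x \<in> \<Omega>" "slant x v = 0"
  shows "slant x (v + u) = slant x u" "slant x (v - u) = slant x u"
proof -
  obtain c where v: "v = c *\<^sub>R E x" using slant_eq_0_imp[OF assms] by blast
  note lin = linear_d[OF assms(1)]
  have E1: "snd (snd (d x (E x))) = 1"
    using mink_d_E[OF assms(1), of "E x"] unit_E[OF assms(1)] by simp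
  show "slant x (v + u) = slant x u" "slant x (v - u) = slant x u"
    unfolding slant_def v using mink_d_E[OF assms(1), of u]
    by (simp_all add: linear_add[OF lin] linear_diff[OF lin] linear_scale[OF lin] mink.add_left mink.add_right
      mink.diff_left mink.diff_right mink.scaleR_left mink.scaleR_right mink_commute[of "d x (E x)" "d x u"]
      unit_E[OF assms(1)] E1 power2_eq_square algebra_simps)
qed

lemma ex_slant:
  assumes "x \<in> \<Omega>" "1 < CARD('n)"
  obtains u where "slant x u \<noteq> 0"
proof -
  have "\<exists>u. u \<notin> span {E x}"
  proof (rule ccontr)
    assume "\<not> ?thesis"
    then have "span {E x} = UNIV" by blast
    then have "dim {E x} = CARD('n)" using dim_eq_full[of "{E x}"] by simp
    moreover have "dim {E x} \<le> 1" using dim_le_card[of "{E x}" "{E x}"] by (simp add: span_base)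
    ultimately show False using assms(2) by simp
  qed
  then obtain u where "u \<notin> span {E x}" by blast
  then show ?thesis using that slant_eq_0_imp[OF assms(1)] by (metis span_base span_scale singletonI)
qed

end

text \<open>The two hypotheses of the theorem in local form: \<open>\<alpha>\<close> has no zero, and the submanifold is isotropic
with \<open>\<lambda> = 0\<close>.\<close>

locale isotropic_cone_immersion = cone_immersion f \<Omega>
  for f :: "real ^ 'n::finite \<Rightarrow> 'n minkowski" and \<Omega> +
  assumes not_vertical: "\<And>x. x \<in> \<Omega> \<Longrightarrow> vertical \<notin> range (d x)"
    and normal_curvature_null: "\<And>x u. x \<in> \<Omega> \<Longrightarrow> mink (normal_curvature f x u) (normal_curvature f x u) = 0"
begin

text \<open>The light-like normal vector \<open>N\<close> with \<open>\<langle>N, \<partial>\<rangle> = 1\<close>, obtained from the second fundamental form on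
\<open>(u, u)\<close> for a coordinate vector \<open>u\<close> that stays fixed. This makes it a smooth function of the point.\<close>

definition null_normal :: "real ^ 'n \<Rightarrow> real ^ 'n \<Rightarrow> 'n minkowski" where
  "null_normal u x = inverse (snd (snd (normal_curvature f x u))) *\<^sub>R normal_curvature f x u"

text \<open>A normal vector pairs with \<open>\<partial> = e\<^sub>1 + k \<theta>\<close> as with \<open>k \<theta>\<close>, and \<open>k\<close> is not zero because \<open>\<partial>\<close> is not
tangent. So the normalization of \<open>N\<close> is possible.\<close>

lemma vertical_normal_curvature:
  assumes "x \<in> \<Omega>" "slant x u \<noteq> 0"
  shows "snd (snd (normal_curvature f x u)) \<noteq> 0"
proof -
  obtain k where k: "vertical - d x (E x) = k *\<^sub>R \<theta> x"
    by (rule vertical_decomposition[OF spacelike on_cone d_normal_\<theta>]) (use assms in auto)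
  have "k \<noteq> 0"
  proof
    assume "k = 0"
    then have "vertical = d x (E x)" using k by simp
    then show False using not_vertical[OF assms(1)] by (metis rangeI)
  qed
  have "vertical = d x (E x) + k *\<^sub>R \<theta> x" using k by (simp add: algebra_simps)
  then have "snd (snd (normal_curvature f x u)) = mink (d x (E x) + k *\<^sub>R \<theta> x) (normal_curvature f x u)"
    by (metis mink_vertical(2))
  also have "\<dots> = - (k * slant x u)"
    using normal_curvature_normal[OF assms(1)] normal_curvature_\<theta>[OF assms(1), of u]
    by (simp add: mink.add_left mink.scaleR_left mink_commute[of "\<theta> x"])
  finally show ?thesis using \<open>k \<noteq> 0\<close> assms(2) by simp
qed

lemma null_normal:
  assumes "x \<in> \<Omega>" "slant x u \<noteq> 0"
  shows "mink (d x v) (null_normal u x) = 0" "mink (null_normal u x) (null_normal u x) = 0"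
    "snd (snd (null_normal u x)) = 1" "mink (null_normal u x) (\<theta> x) \<noteq> 0"
  using vertical_normal_curvature[OF assms] normal_curvature_normal[OF assms(1)] normal_curvature_null[OF assms(1)]
    normal_curvature_\<theta>[OF assms(1)] assms(2)
  by (simp_all add: null_normal_def mink.scaleR_left mink.scaleR_right)

lemma null_frame:
  assumes "x \<in> \<Omega>" "slant x u \<noteq> 0" "\<And>v. mink (d x v) w = 0"
  shows "\<exists>a b. w = a *\<^sub>R \<theta> x + b *\<^sub>R null_normal u x"
  using normal_null_frame[OF spacelike[OF assms(1)] horizontal_null[OF on_cone[OF assms(1)]]
      d_normal_\<theta>[OF assms(1)] null_normal(1)[OF assms(1,2)] null_normal(4)[OF assms(1,2)] assms(3)] .

text \<open>In the frame of the two light-like vectors \<open>\<theta>\<close> and \<open>N\<close>, the light-like vector \<open>h(v, v)\<close> is a multiple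
of one of them. It is not a multiple of \<open>\<theta>\<close>, because its \<open>\<theta>\<close>-component is not zero.\<close>

lemma second_derivative_null_normal_slant:
  assumes "x \<in> \<Omega>" "slant x u \<noteq> 0" "slant x v \<noteq> 0"
  shows "mink (second_derivative f x v v) (null_normal u x) = 0"
proof -
  let ?N = "null_normal u x"
  obtain a b where h: "normal_curvature f x v = a *\<^sub>R \<theta> x + b *\<^sub>R ?N"
    using null_frame[OF assms(1,2) normal_curvature_normal[OF assms(1)]] by blast
  note \<theta>0 = horizontal_null(2)[OF on_cone[OF assms(1)]]
  have hN: "mink (normal_curvature f x v) ?N = a * mink ?N (\<theta> x)"
    using null_normal(2)[OF assms(1,2)]
    by (simp add: h mink.add_left mink.scaleR_left mink_commute[of "\<theta> x" ?N])
  have "b * mink ?N (\<theta> x) = - slant x v"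
    using normal_curvature_\<theta>[OF assms(1), of v] \<theta>0 by (simp add: h mink.add_left mink.scaleR_left)
  moreover have "2 * a * (b * mink ?N (\<theta> x)) = 0"
    using normal_curvature_null[OF assms(1), of v] \<theta>0 null_normal(2)[OF assms(1,2)]
    by (simp add: h mink.add_left mink.add_right mink.scaleR_left mink.scaleR_right mink_commute[of "\<theta> x" ?N])
  ultimately have "a = 0" using assms(3) by auto
  then show ?thesis
    using hN normal_curvature_pair[OF assms(1) null_normal(1)[OF assms(1,2)]] by simp
qed

text \<open>For \<open>v\<close> on the line of \<open>e\<^sub>1\<close> the claim follows from the parallelogram identity of the quadratic form
\<open>v \<mapsto> \<langle>f\<^sub>v\<^sub>v, N\<rangle>\<close>, since \<open>u\<close>, \<open>v + u\<close> and \<open>v - u\<close> are off this line.\<close>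

lemma second_derivative_null_normal_diagonal:
  assumes "x \<in> \<Omega>" "slant x u \<noteq> 0"
  shows "mink (second_derivative f x v v) (null_normal u x) = 0"
proof (cases "slant x v = 0")
  case True
  have "mink (second_derivative f x (v + u) (v + u)) (null_normal u x) = 0"
    "mink (second_derivative f x (v - u) (v - u)) (null_normal u x) = 0"
    "mink (second_derivative f x u u) (null_normal u x) = 0"
    using slant_add_diff[OF assms(1) True, of u] assms(2)
    by (auto intro!: second_derivative_null_normal_slant[OF assms])
  then show ?thesis
    by (simp add: second_derivative_add_left second_derivative_add_right second_derivative_diff_left
      second_derivative_diff_right assms(1) mink.add_left mink.diff_left)
qed (rule second_derivative_null_normal_slant[OF assms])

text \<open>Polarization, by the symmetry of the second derivative.\<close>

lemma second_derivative_null_normal: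
  assumes "x \<in> \<Omega>" "slant x u \<noteq> 0"
  shows "mink (second_derivative f x v w) (null_normal u x) = 0"
  using second_derivative_null_normal_diagonal[OF assms, of "v + w"]
    second_derivative_null_normal_diagonal[OF assms, of v]
    second_derivative_null_normal_diagonal[OF assms, of w]
  by (simp add: second_derivative_add_left second_derivative_add_right assms(1) mink.add_left
    second_derivative_sym[OF assms(1), of w v])

lemma smooth_normal_curvature: "smooth_on \<Omega> (\<lambda>x. normal_curvature f x u)"
proof -
  let ?c = "\<lambda>x. tangent_coords (d x) (second_derivative f x u u)"
  have c: "smooth_on \<Omega> ?c"
    unfolding tangent_coords_def
  proof (rule smooth_on_cramer_solution[OF open_domain])
    show "smooth_on \<Omega> (\<lambda>x. gram (d x) $ i $ j)" for i j
      by (simp add: gram_def smooth_on_bilinear[OF open_domain bounded_bilinear_mink smooth_d smooth_d])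
    show "smooth_on \<Omega> (\<lambda>x. (\<chi> i. mink (d x (axis i 1)) (second_derivative f x u u)) $ i)" for i
      by (simp add: smooth_on_bilinear[OF open_domain bounded_bilinear_mink smooth_d smooth_dd])
    show "det (gram (d x)) \<noteq> 0" if "x \<in> \<Omega>" for x by (rule det_gram[OF spacelike[OF that]])
  qed
  have "smooth_on \<Omega> (\<lambda>x. second_derivative f x u u + - (\<Sum>i\<in>UNIV. (?c x $ i) *\<^sub>R d x (axis i 1)))"
    by (intro smooth_on_add[OF open_domain] smooth_dd
        smooth_on_linear[OF open_domain bounded_linear_minus[OF bounded_linear_ident]]
        smooth_on_sum[OF open_domain] smooth_on_bilinear[OF open_domain bounded_bilinear_scaleR] smooth_d
        smooth_on_linear[OF open_domain bounded_linear_vec_nth] c)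
  then show ?thesis
  proof (rule smooth_on_cong[OF _ open_domain])
    fix x assume "x \<in> \<Omega>"
    then show "second_derivative f x u u + - (\<Sum>i\<in>UNIV. (?c x $ i) *\<^sub>R d x (axis i 1)) = normal_curvature f x u"
      unfolding normal_curvature_def using linear_axis_expansion[OF linear_d, of x "?c x"] by simp
  qed
qed

lemma smooth_null_normal:
  assumes "open S" "S \<subseteq> \<Omega>" "\<And>x. x \<in> S \<Longrightarrow> slant x u \<noteq> 0"
  shows "smooth_on S (null_normal u)"
proof -
  have h: "smooth_on S (\<lambda>x. normal_curvature f x u)"
    using smooth_on_subset[OF smooth_normal_curvature assms(2)] .
  have "smooth_on S (\<lambda>x. snd (snd (normal_curvature f x u)))"
    by (intro smooth_on_linear[OF assms(1) bounded_linear_snd] h)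
  then show ?thesis
    unfolding null_normal_def[abs_def] using assms vertical_normal_curvature h
    by (intro smooth_on_bilinear[OF assms(1) bounded_bilinear_scaleR] smooth_on_inverse) auto
qed

text \<open>The derivative of \<open>N\<close> is normal because \<open>\<langle>f\<^sub>v\<^sub>w, N\<rangle> = 0\<close>, orthogonal to \<open>N\<close> because \<open>N\<close> is light-like,
and orthogonal to \<open>\<partial>\<close> by the normalization of \<open>N\<close>. In the frame of \<open>\<theta>\<close> and \<open>N\<close> these conditions leave
only the zero vector.\<close>

lemma null_normal_derivative_0:
  assumes "open S" "S \<subseteq> \<Omega>" "\<And>x. x \<in> S \<Longrightarrow> slant x u \<noteq> 0" "x \<in> S"
  shows "(null_normal u has_derivative (\<lambda>v. 0)) (at x)"
proof -
  let ?N = "null_normal u"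
  let ?z = "frechet_derivative ?N (at x)"
  have x: "x \<in> \<Omega>" "slant x u \<noteq> 0" using assms by auto
  have dN: "(?N has_derivative ?z) (at x)"
    by (rule smooth_on_has_derivative[OF smooth_null_normal[OF assms(1-3)] assms(1,4)])
  have const: "(g has_derivative (\<lambda>v. 0)) (at x)" if "\<And>y. y \<in> S \<Longrightarrow> g y = c" for g :: "real ^ 'n \<Rightarrow> real" and c
    by (rule has_derivative_transform_within_open[OF has_derivative_const assms(1,4)]) (use that in auto)
  have "?z v = 0" for v
  proof -
    have 1: "mink (d x w) (?z v) = 0" for w
    proof -
      have "((\<lambda>y. mink (d y w) (?N y)) has_derivative (\<lambda>v. mink (d x w) (?z v) + mink (second_derivative f x w v) (?N x))) (at x)"
        by (rule mink.FDERIV[OF d_has_derivative[OF x(1)] dN])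
      moreover have "((\<lambda>y. mink (d y w) (?N y)) has_derivative (\<lambda>v. 0)) (at x)"
        using null_normal(1) assms(2,3) by (intro const) auto
      ultimately have "(\<lambda>v. mink (d x w) (?z v) + mink (second_derivative f x w v) (?N x)) = (\<lambda>v. 0)"
        by (rule has_derivative_unique)
      from fun_cong[OF this, of v] show ?thesis
        using second_derivative_null_normal[OF x, of w v] by simp
    qed
    have 2: "mink (?z v) (?N x) = 0"
    proof -
      have "((\<lambda>y. mink (?N y) (?N y)) has_derivative (\<lambda>v. mink (?N x) (?z v) + mink (?z v) (?N x))) (at x)"
        by (rule mink.FDERIV[OF dN dN])
      moreover have "((\<lambda>y. mink (?N y) (?N y)) has_derivative (\<lambda>v. 0)) (at x)"
        using null_normal(2) assms(2,3) by (intro const) auto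
      ultimately have "(\<lambda>v. mink (?N x) (?z v) + mink (?z v) (?N x)) = (\<lambda>v. 0)"
        by (rule has_derivative_unique)
      from fun_cong[OF this, of v] show ?thesis by (simp add: mink_commute)
    qed
    have 3: "snd (snd (?z v)) = 0"
    proof -
      have "((\<lambda>y. snd (snd (?N y))) has_derivative (\<lambda>v. snd (snd (?z v)))) (at x)"
        by (intro has_derivative_snd dN)
      moreover have "((\<lambda>y. snd (snd (?N y))) has_derivative (\<lambda>v. 0)) (at x)"
        using null_normal(3) assms(2,3) by (intro const) auto
      ultimately have "(\<lambda>v. snd (snd (?z v))) = (\<lambda>v. 0)"
        by (rule has_derivative_unique)
      from fun_cong[OF this, of v] show ?thesis .
    qed
    obtain a b where z: "?z v = a *\<^sub>R \<theta> x + b *\<^sub>R ?N x"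
      using null_frame[OF x 1] by blast
    have "a = 0"
      using 2 null_normal(2,4)[OF x] by (simp add: z mink.add_left mink.scaleR_left mink_commute[of "\<theta> x"])
    moreover have "b = 0"
      using 3 null_normal(3)[OF x] by (simp add: z horizontal_def)
    ultimately show ?thesis using z by simp
  qed
  then have "?z = (\<lambda>v. 0)" by (rule ext)
  then show ?thesis using dN by (simp only:)
qed

text \<open>As \<open>N\<close> is constant and normal, the derivative of \<open>\<langle>N, f\<rangle>\<close> vanishes.\<close>

lemma lies_on_null_hyperplane:
  assumes "x0 \<in> \<Omega>" "1 < CARD('n)"
  obtains N r c where "0 < r" "ball x0 r \<subseteq> \<Omega>" "mink N N = 0" "snd (snd N) = 1"
    "\<And>x. x \<in> ball x0 r \<Longrightarrow> mink N (f x) = c"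
proof -
  obtain u where u: "slant x0 u \<noteq> 0" using ex_slant[OF assms] .
  \<comment> \<open>The field \<open>N\<close> is available as long as \<^term>\<open>u\<close> is not proportional to \<open>e\<^sub>1\<close>, which is an open condition.\<close>
  have "smooth_on \<Omega> (\<lambda>x. mink (d x u) (d x u) + - (snd (snd (d x u)) * snd (snd (d x u))))"
    by (intro smooth_on_add[OF open_domain] smooth_on_bilinear[OF open_domain bounded_bilinear_mink] smooth_d
      smooth_on_linear[OF open_domain bounded_linear_minus[OF bounded_linear_ident]]
      smooth_on_bilinear[OF open_domain bounded_bilinear_mult] smooth_on_linear[OF open_domain bounded_linear_snd])
  then have "continuous_on \<Omega> (\<lambda>x. slant x u)"
    unfolding slant_def power2_eq_square using smooth_on_imp_continuous by force
  then have "open (\<Omega> \<inter> (\<lambda>x. slant x u) -` (- {0}))"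
    by (rule continuous_open_preimage) (auto simp: open_domain)
  then obtain r where r: "0 < r" "ball x0 r \<subseteq> \<Omega> \<inter> (\<lambda>x. slant x u) -` (- {0})"
    using u assms(1) by (metis Compl_iff IntI open_contains_ball singletonD vimageI2)
  let ?B = "ball x0 r"
  have B: "open ?B" "?B \<subseteq> \<Omega>" "\<And>x. x \<in> ?B \<Longrightarrow> slant x u \<noteq> 0" "x0 \<in> ?B" using r by auto
  let ?N = "null_normal u x0"
  have N: "null_normal u x = ?N" if "x \<in> ?B" for x
    using has_derivative_zero_unique_connected[OF B(1) _ null_normal_derivative_0[OF B(1-3)] that B(4)] by auto
  have "mink ?N (f x) = mink ?N (f x0)" if "x \<in> ?B" for x
  proof (rule has_derivative_zero_unique_connected[OF B(1) _ _ that B(4)])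
    fix y assume y: "y \<in> ?B"
    have "((\<lambda>x. mink ?N (f x)) has_derivative (\<lambda>v. mink ?N (d y v))) (at y)"
      by (rule bounded_linear.has_derivative[OF mink.bounded_linear_right f_has_derivative]) (use y B in auto)
    moreover have "mink ?N (d y v) = 0" for v
      using null_normal(1)[of y u v] N[OF y] y B by (auto simp: mink_commute)
    ultimately show "((\<lambda>x. mink ?N (f x)) has_derivative (\<lambda>v. 0)) (at y)" by simp
  qed auto
  then show ?thesis
    using that[OF r(1) B(2) null_normal(2,3)[OF assms(1) u]] by blast
qed

end

section \<open>Rotating a timelike vector to the time axis\<close>

text \<open>The Minkowski form of the hyperplane \<open>x\<^bsub>n+2\<^esub> = 0\<close>.\<close>

definition lorentz :: "real \<times> (real ^ 'n::finite) \<Rightarrow> real \<times> (real ^ 'n) \<Rightarrow> real" where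
  "lorentz u v = - (fst u * fst v) + snd u \<bullet> snd v"

lemma mink_lorentz: "mink x y = lorentz (fst x, fst (snd x)) (fst y, fst (snd y)) + snd (snd x) * snd (snd y)"
  by (simp add: mink_eq lorentz_def)

lemma lorentz_simps:
  "lorentz (u + v) w = lorentz u w + lorentz v w" "lorentz w (u + v) = lorentz w u + lorentz w v"
  "lorentz (u - v) w = lorentz u w - lorentz v w" "lorentz w (u - v) = lorentz w u - lorentz w v"
  "lorentz (c *\<^sub>R u) w = c * lorentz u w" "lorentz w (c *\<^sub>R u) = c * lorentz w u"
  by (simp_all add: lorentz_def inner_simps algebra_simps)

lemma lorentz_commute: "lorentz u v = lorentz v u"
  by (simp add: lorentz_def inner_commute mult.commute)

text \<open>The reflection in the hyperplane orthogonal to \<^term>\<open>e\<close>. For a light-like \<^term>\<open>e\<close> the quotient is zero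
and the map is the identity, so it is an isometry in every case.\<close>

definition lorentz_reflection :: "real \<times> (real ^ 'n::finite) \<Rightarrow> real \<times> (real ^ 'n) \<Rightarrow> real \<times> (real ^ 'n)" where
  "lorentz_reflection e v = v - (2 * lorentz v e / lorentz e e) *\<^sub>R e"

lemma linear_lorentz_reflection: "linear (lorentz_reflection e)"
  unfolding lorentz_reflection_def
  by (rule linearI) (simp_all add: lorentz_simps(1,5) algebra_simps add_divide_distrib)

lemma lorentz_lorentz_reflection:
  "lorentz (lorentz_reflection e u) (lorentz_reflection e v) = lorentz u v"
proof (cases "lorentz e e = 0")
  case False
  define a b where "a = 2 * lorentz u e / lorentz e e" and "b = 2 * lorentz v e / lorentz e e"
  have "lorentz (lorentz_reflection e u) (lorentz_reflection e v) =
      lorentz u v - b * lorentz u e - a * lorentz v e + a * b * lorentz e e"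
    unfolding lorentz_reflection_def a_def[symmetric] b_def[symmetric]
    by (simp add: lorentz_simps(3-6) lorentz_commute[of e v] algebra_simps)
  also have "\<dots> = lorentz u v"
    using False by (simp add: a_def b_def)
  finally show ?thesis .
qed (simp add: lorentz_reflection_def)

lemma lorentz_lorentz_reflection_right:
  "lorentz w (lorentz_reflection e v) = lorentz w v - 2 * lorentz v e / lorentz e e * lorentz e w"
  by (simp add: lorentz_reflection_def lorentz_simps(4,6) lorentz_commute[of w e])

text \<open>The reflection that exchanges \<^term>\<open>w\<close> with the vector \<open>(\<plusminus>1, 0)\<close> of the same time orientation. As it
maps a time-like vector to one of the same orientation, it preserves the forward light cone. Pairing
with \<^term>\<open>w\<close> becomes pairing with \<open>(\<plusminus>1, 0)\<close>, which is the time coordinate up to sign.\<close>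

lemma rotate_timelike_to_axis:
  fixes w :: "real \<times> (real ^ 'n::finite)"
  assumes w: "lorentz w w = -1"
  shows "\<exists>\<epsilon> (L :: real \<times> (real ^ 'n) \<Rightarrow> real \<times> (real ^ 'n)). \<epsilon> \<in> {1, -1} \<and> linear L \<and> (\<forall>u v. lorentz (L u) (L v) = lorentz u v) \<and>
    (\<forall>v. lorentz w v = - \<epsilon> * fst (L v)) \<and>
    (\<forall>v. 0 < fst v \<longrightarrow> norm (snd v) = fst v \<longrightarrow> 0 < fst (L v))"
proof -
  obtain a y where wa: "w = (a, y)" by (cases w)
  have a2: "a\<^sup>2 = 1 + (norm y)\<^sup>2"
    using w by (simp add: wa lorentz_def power2_norm_eq_inner) (simp add: power2_eq_square)
  have "norm y < \<bar>a\<bar>"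
    by (rule power2_less_imp_less) (simp_all add: a2)
  then have a1: "a \<noteq> 0" by auto
  \<comment> \<open>The sign of the time coordinate of \<^term>\<open>w\<close>, so that the target has the same time orientation.\<close>
  define \<epsilon> :: real where "\<epsilon> = sgn a"
  have \<epsilon>: "\<epsilon> \<in> {1, -1}" "\<epsilon> * \<epsilon> = 1" "\<epsilon> * a = \<bar>a\<bar>"
    using a1 by (auto simp: \<epsilon>_def sgn_if)
  let ?w1 = "(\<epsilon>, 0) :: real \<times> (real ^ 'n)"
  let ?d = "w - ?w1"
  have w1: "lorentz ?w1 ?w1 = -1" "lorentz w ?w1 = - \<bar>a\<bar>" "\<And>v. lorentz ?w1 v = - \<epsilon> * fst v"
    using \<epsilon> by (simp_all add: lorentz_def wa mult.commute)
  have dd: "lorentz ?d ?d = 2 * \<bar>a\<bar> - 2" "lorentz ?d ?w1 = 1 - \<bar>a\<bar>"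
    unfolding lorentz_simps w w1(1,2) lorentz_commute[of ?w1 w] by simp_all
  define L where "L = lorentz_reflection ?d"
  have L: "linear L" and iso: "lorentz (L u) (L v) = lorentz u v" for u v
    by (simp_all add: L_def linear_lorentz_reflection lorentz_lorentz_reflection)
  have Lw: "lorentz ?w1 (L v) = lorentz w v" for v
    \<comment> \<open>In the first case \<^term>\<open>w\<close> is already the target vector and the reflection degenerates to the
      identity.\<close>
  proof (cases "\<bar>a\<bar> = 1")
    case True
    then have "y = 0" using a2 by (simp add: power2_eq_1_iff abs_if split: if_splits)
    then have "?d = 0" using True \<epsilon> by (auto simp: wa \<epsilon>_def sgn_if zero_prod_def split: if_splits)
    then show ?thesis by (simp add: L_def lorentz_reflection_def)
  next
    case False
    have "lorentz ?w1 (L v) = lorentz ?w1 v - 2 * lorentz v ?d / lorentz ?d ?d * lorentz ?d ?w1"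
      unfolding L_def by (rule lorentz_lorentz_reflection_right)
    also have "\<dots> = lorentz ?w1 v + lorentz v ?d"
      unfolding dd using False by (simp add: field_simps)
    also have "\<dots> = lorentz w v"
      by (simp add: lorentz_simps lorentz_commute)
    finally show ?thesis .
  qed
  have pos: "0 < fst (L v)" if v: "0 < fst v" "norm (snd v) = fst v" for v
  proof -
    have "\<epsilon> * (y \<bullet> snd v) \<le> norm y * norm (snd v)"
      using Cauchy_Schwarz_ineq2[of y "snd v"] \<epsilon>(1) by auto
    also have "\<dots> < \<bar>a\<bar> * fst v"
      using \<open>norm y < \<bar>a\<bar>\<close> v by simp
    finally have "0 < - (\<epsilon> * lorentz w v)"
      using \<epsilon>(3) by (simp add: wa lorentz_def algebra_simps mult.assoc[symmetric])
    moreover have "\<epsilon> * lorentz w v = - fst (L v)"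
      using w1(3)[of "L v"] Lw[of v] \<epsilon>(2) by (simp add: mult.assoc[symmetric])
    ultimately show ?thesis by simp
  qed
  show ?thesis
    by (intro exI[of _ \<epsilon>] exI[of _ L] conjI allI impI \<epsilon>(1) L iso pos) (simp only: Lw[symmetric] w1(3))
qed

definition rotation :: "(real \<times> (real ^ 'n) \<Rightarrow> real \<times> (real ^ 'n)) \<Rightarrow> 'n::finite minkowski \<Rightarrow> 'n minkowski" where
  "rotation L x = (fst (L (fst x, fst (snd x))), snd (L (fst x, fst (snd x))), snd (snd x))"

lemma hyperplane_rotation_rotation:
  assumes "linear L" "\<And>u v. lorentz (L u) (L v) = lorentz u v"
  shows "hyperplane_rotation (rotation L)"
  unfolding hyperplane_rotation_def rotation_def
  using assms by (intro exI[of _ L]) (auto simp: mink_lorentz)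

lemma hyperplane_rotation_mink:
  assumes "hyperplane_rotation Q" shows "mink (Q x) (Q y) = mink x y"
proof -
  obtain L where L: "\<And>u v. lorentz (L u) (L v) = lorentz u v" "\<And>a y b. Q (a, y, b) = (fst (L (a, y)), snd (L (a, y)), b)"
    using assms by (force simp: hyperplane_rotation_def mink_lorentz)
  show ?thesis by (cases x; cases y) (simp add: L mink_lorentz)
qed

lemma hyperplane_rotation_linear:
  assumes "hyperplane_rotation Q" shows "linear Q"
proof -
  obtain L where L: "linear L" "\<And>a y b. Q (a, y, b) = (fst (L (a, y)), snd (L (a, y)), b)"
    using assms by (force simp: hyperplane_rotation_def)
  show ?thesis
  proof (rule linearI)
    fix x y :: "'a minkowski" and c :: real
    show "Q (x + y) = Q x + Q y"
      using linear_add[OF L(1), of "(fst x, fst (snd x))" "(fst y, fst (snd y))"]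
      by (cases x; cases y) (simp add: L(2))
    show "Q (c *\<^sub>R x) = c *\<^sub>R Q x"
      using linear_scale[OF L(1), of c "(fst x, fst (snd x))"]
      by (cases x) (simp add: L(2))
  qed
qed

text \<open>An isometry of a nondegenerate form is injective.\<close>

lemma hyperplane_rotation_inj:
  assumes "hyperplane_rotation Q" shows "inj Q"
proof -
  have "x = 0" if "Q x = 0" for x
  proof (rule mink_nondegenerate)
    fix v show "mink v x = 0"
      using hyperplane_rotation_mink[OF assms, of v x] that by (simp add: mink.zero_right)
  qed
  then show ?thesis using linear_injective_0[OF hyperplane_rotation_linear[OF assms]] by blast
qed

section \<open>Stereographic coordinates on the sphere\<close>

text \<open>Stereographic projection from the coordinate vector of the index \<^term>\<open>pole\<close>; \<^term>\<open>\<beta>\<close> identifies the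
coordinates of the equatorial hyperplane with the remaining indices.\<close>

locale stereographic =
  fixes pole :: "'n::finite" and \<beta> :: "'k::finite \<Rightarrow> 'n"
  assumes bij: "bij_betw \<beta> UNIV (- {pole})"
begin

definition proj :: "real ^ 'n \<Rightarrow> real ^ 'k" where
  "proj y = (\<chi> j. (y $ \<beta> j) * inverse (1 - y $ pole))"

definition param :: "real ^ 'k \<Rightarrow> real ^ 'n" where
  "param t = (\<chi> i. (if i = pole then t \<bullet> t - 1 else 2 * t $ inv \<beta> i) * inverse (t \<bullet> t + 1))"

lemma inj_\<beta>: "inj \<beta>" using bij by (simp add: bij_betw_def)

lemma \<beta>_not_pole [simp]: "\<beta> j \<noteq> pole"
  using bij by (auto simp: bij_betw_def)

lemma inv_\<beta> [simp]: "inv \<beta> (\<beta> j) = j" by (simp add: inj_\<beta>)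

lemma \<beta>_inv: "i \<noteq> pole \<Longrightarrow> \<beta> (inv \<beta> i) = i"
  using bij by (auto simp: bij_betw_def intro: f_inv_into_f)

lemma sum_split: "(\<Sum>i\<in>UNIV. g i) = g pole + (\<Sum>j\<in>UNIV. g (\<beta> j))" for g :: "'n \<Rightarrow> real"
proof -
  have "(\<Sum>i\<in>UNIV. g i) = g pole + (\<Sum>i\<in>- {pole}. g i)"
    by (simp add: sum.remove[of UNIV pole] Compl_eq_Diff_UNIV)
  then show ?thesis using sum.reindex_bij_betw[OF bij, of g] by simp
qed

lemma norm_pos: "0 < t \<bullet> t + 1" for t :: "real ^ 'k"
  by (simp add: add_nonneg_pos)

lemma param_norm: "norm (param t) = 1"
proof -
  let ?s = "t \<bullet> t"
  have "param t \<bullet> param t = (?s - 1)\<^sup>2 * (inverse (?s + 1))\<^sup>2 + (\<Sum>j\<in>UNIV. 4 * (t $ j * t $ j) * (inverse (?s + 1))\<^sup>2)"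
    by (simp add: inner_vec_def[of "param t"] sum_split) (simp add: param_def power2_eq_square algebra_simps)
  also have "\<dots> = ((?s - 1)\<^sup>2 + 4 * ?s) * (inverse (?s + 1))\<^sup>2"
    by (simp add: inner_vec_def[of t t] sum_distrib_left sum_distrib_right distrib_right)
  also have "(?s - 1)\<^sup>2 + 4 * ?s = (?s + 1)\<^sup>2"
    by (simp add: power2_eq_square algebra_simps)
  also have "(?s + 1)\<^sup>2 * (inverse (?s + 1))\<^sup>2 = 1"
    using norm_pos[of t] by (simp add: power_mult_distrib[symmetric])
  finally show ?thesis by (simp add: norm_eq_1)
qed

lemma param_pole: "1 - param t $ pole = 2 * inverse (t \<bullet> t + 1)"
  using norm_pos[of t] by (simp add: param_def field_simps)

lemma proj_param: "proj (param t) = t"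
proof -
  have "param t $ \<beta> j * inverse (1 - param t $ pole) = t $ j" for j
    unfolding param_pole using norm_pos[of t] by (simp add: param_def)
  then show ?thesis by (simp add: proj_def vec_eq_iff)
qed

lemma param_proj:
  assumes "norm y = 1" "y $ pole \<noteq> 1"
  shows "param (proj y) = y"
proof -
  let ?q = "1 - y $ pole"
  have q: "?q \<noteq> 0" using assms(2) by simp
  have "1 = y \<bullet> y" using assms(1) by (simp add: norm_eq_1)
  also have "\<dots> = (y $ pole)\<^sup>2 + (\<Sum>j\<in>UNIV. y $ \<beta> j * y $ \<beta> j)"
    by (simp add: inner_vec_def sum_split power2_eq_square)
  finally have s: "(\<Sum>j\<in>UNIV. y $ \<beta> j * y $ \<beta> j) = 1 - (y $ pole)\<^sup>2" by simp
  have "proj y \<bullet> proj y = (\<Sum>j\<in>UNIV. y $ \<beta> j * y $ \<beta> j) * (inverse ?q)\<^sup>2"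
    unfolding sum_distrib_right by (simp add: inner_vec_def proj_def power2_eq_square ac_simps)
  also have "\<dots> = (1 + y $ pole) * inverse ?q"
  proof -
    have "1 - (y $ pole)\<^sup>2 = (1 + y $ pole) * ?q" by (simp add: power2_eq_square algebra_simps)
    then show ?thesis unfolding s using q by (simp add: power2_eq_square)
  qed
  finally have pp: "proj y \<bullet> proj y = (1 + y $ pole) * inverse ?q" .
  have p1: "proj y \<bullet> proj y + 1 = 2 * inverse ?q" "proj y \<bullet> proj y - 1 = 2 * y $ pole * inverse ?q"
    unfolding pp using q by (simp_all add: field_simps)
  have "param (proj y) $ i = y $ i" for i
  proof (cases "i = pole")
    case True then show ?thesis
      unfolding param_def p1 using q by simp
  next
    case False
    then have "proj y $ inv \<beta> i = y $ i * inverse ?q"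
      by (simp add: proj_def \<beta>_inv)
    then show ?thesis using False q p1 by (simp add: param_def)
  qed
  then show ?thesis by (simp add: vec_eq_iff)
qed

lemma smooth_param: "smooth_on UNIV param"
proof (rule smooth_on_vec)
  fix i
  have inner: "smooth_on UNIV (\<lambda>t::real^'k. t \<bullet> t)"
    by (rule smooth_on_bilinear[OF open_UNIV bounded_bilinear_inner smooth_on_id[OF open_UNIV] smooth_on_id[OF open_UNIV]])
  have num: "smooth_on UNIV (\<lambda>t. if i = pole then t \<bullet> t - 1 else 2 * t $ inv \<beta> i)"
  proof (cases "i = pole")
    case True then show ?thesis using smooth_on_add[OF _ inner smooth_on_const, of "- 1"] by simp
  next
    case False
    have "smooth_on UNIV (\<lambda>t::real^'k. 2 * t $ inv \<beta> i)"
      by (intro smooth_on_bilinear[OF _ bounded_bilinear_mult] smooth_on_const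
          smooth_on_linear[OF _ bounded_linear_vec_nth] smooth_on_id) auto
    then show ?thesis using False by simp
  qed
  have "smooth_on UNIV (\<lambda>t::real^'k. inverse (t \<bullet> t + 1))"
    using norm_pos by (intro smooth_on_inverse smooth_on_add inner smooth_on_const) (auto simp: less_imp_neq[symmetric])
  from smooth_on_bilinear[OF _ bounded_bilinear_mult num this]
  show "smooth_on UNIV (\<lambda>t. param t $ i)" by (simp add: param_def)
qed simp

lemma smooth_proj: "open S \<Longrightarrow> (\<And>y. y \<in> S \<Longrightarrow> y $ pole \<noteq> 1) \<Longrightarrow> smooth_on S proj"
  unfolding proj_def
proof (rule smooth_on_vec, assumption, unfold vec_lambda_beta)
  fix j assume S: "open S" "\<And>y. y \<in> S \<Longrightarrow> y $ pole \<noteq> 1"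
  have c: "smooth_on S (\<lambda>y. y $ i)" for i
    by (intro smooth_on_linear[OF S(1) bounded_linear_vec_nth] smooth_on_id S)
  have "smooth_on S (\<lambda>y. 1 + - (y $ pole))"
    by (intro smooth_on_add[OF S(1)] smooth_on_const smooth_on_linear[OF S(1) bounded_linear_minus[OF bounded_linear_ident]] c)
  then have "smooth_on S (\<lambda>y. 1 - y $ pole)" by simp
  then show "smooth_on S (\<lambda>y. y $ \<beta> j * inverse (1 - y $ pole))"
    using S(2) by (intro smooth_on_bilinear[OF S(1) bounded_bilinear_mult] smooth_on_inverse S(1) c) auto
qed

text \<open>Injectivity of the differential comes from the chain rule for the left inverse \<^term>\<open>proj\<close>.\<close>

lemma sphere_parametrization_param: "sphere_parametrization UNIV param"
  unfolding sphere_parametrization_def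
proof (intro conjI ballI)
  show "inj param" by (metis injI proj_param)
  fix t
  have S: "open {y :: real^'n. y $ pole \<noteq> 1}"
    by (intro open_Collect_neq continuous_intros)
  have "(proj has_derivative frechet_derivative proj (at (param t))) (at (param t))"
    using param_pole[of t] norm_pos[of t]
    by (intro smooth_on_has_derivative[OF smooth_proj[OF S] S]) auto
  from has_derivative_compose[OF smooth_on_has_derivative[OF smooth_param open_UNIV] this]
  have "((\<lambda>x. x) has_derivative (\<lambda>v. frechet_derivative proj (at (param t)) (frechet_derivative param (at t) v))) (at t)"
    by (simp add: proj_param)
  then have "(\<lambda>v. frechet_derivative proj (at (param t)) (frechet_derivative param (at t) v)) = (\<lambda>v. v)"
    using has_derivative_unique has_derivative_ident by blast
  from fun_cong[OF this] show "inj (frechet_derivative param (at t))"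
    by (rule inj_on_inverseI)
qed (use smooth_param param_norm in auto)

end

text \<open>Some coordinate differs from 1, since a vector with all coordinates 1 has squared length \<open>n > 1\<close>.\<close>

lemma ex_stereographic:
  fixes y :: "real ^ 'n::finite"
  assumes "CARD('n) = CARD('k::finite) + 1" "norm y = 1"
  obtains pole and \<beta> :: "'k::finite \<Rightarrow> 'n" where "stereographic pole \<beta>" "y $ pole \<noteq> 1"
proof -
  have "\<exists>pole. y $ pole \<noteq> 1"
  proof (rule ccontr)
    assume "\<not> ?thesis"
    then have "y \<bullet> y = real CARD('n)" by (simp add: inner_vec_def)
    moreover have "y \<bullet> y = 1" using assms(2) by (simp add: norm_eq_1)
    ultimately show False using assms(1) by simp
  qed
  then obtain pole where pole: "y $ pole \<noteq> 1" by blast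
  have "card (UNIV :: 'k set) = card (- {pole})"
    using assms(1) by (simp add: Compl_eq_Diff_UNIV)
  then obtain \<beta> :: "'k \<Rightarrow> 'n" where "bij_betw \<beta> UNIV (- {pole})"
    using finite_same_card_bij[of "UNIV :: 'k set" "- {pole}"] by auto
  then show ?thesis using that pole by (simp add: stereographic_def)
qed

section \<open>The local normal form\<close>

lemma smooth_cone_parametrization:
  fixes \<Theta> :: "real ^ 'k::finite \<Rightarrow> real ^ 'n::finite"
  assumes "smooth_on UNIV \<Theta>"
  shows "smooth_on UNIV (cone_parametrization \<epsilon> c \<Theta>)"
proof -
  have s: "smooth_on UNIV (\<lambda>p::real \<times> (real ^ 'k). \<epsilon> * fst p + c)"
    by (intro smooth_on_add smooth_on_const smooth_on_linear[OF _ bounded_linear_const_mult[OF bounded_linear_fst]])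
      (auto simp: smooth_on_def Ck_on_id)
  have t: "smooth_on UNIV (\<lambda>p::real \<times> (real ^ 'k). \<Theta> (snd p))"
    by (rule smooth_on_compose[OF _ _ assms smooth_on_linear[OF _ bounded_linear_snd]])
      (auto simp: smooth_on_def Ck_on_id)
  have "smooth_on UNIV (\<lambda>p. (\<epsilon> * fst p + c, (\<epsilon> * fst p + c) *\<^sub>R \<Theta> (snd p), fst p))"
    by (intro smooth_on_Pair s smooth_on_bilinear[OF _ bounded_bilinear_scaleR] t smooth_on_linear[OF _ bounded_linear_fst])
      (auto simp: smooth_on_def Ck_on_id)
  then show ?thesis by (rule smooth_on_cong) (auto simp: split_beta)
qed

text \<open>Rotate so that the light-like normal vector becomes \<open>(\<epsilon>, 0, 1)\<close> and read off the height and the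
stereographic coordinates of the direction. The parametrization composed with these coordinates is
the rotated immersion, so the coordinates have an injective differential and the inverse function
theorem applies.\<close>

lemma (in isotropic_cone_immersion) local_cone_form:
  assumes "x0 \<in> \<Omega>" "1 < CARD('n)" "CARD('n) = CARD('k::finite) + 1"
  obtains Q \<epsilon> c U W g g' and \<Theta> :: "real ^ 'k \<Rightarrow> real ^ 'n" where
    "hyperplane_rotation Q" "\<epsilon> \<in> {1, -1}" "sphere_parametrization UNIV \<Theta>"
    "open U" "x0 \<in> U" "U \<subseteq> \<Omega>" "open W" "W \<subseteq> {(s, t). 0 < \<epsilon> * s + c}"
    "homeomorphism U W g g'" "smooth_on U g" "smooth_on W g'"
    "\<And>x. x \<in> U \<Longrightarrow> Q (f x) = cone_parametrization \<epsilon> c \<Theta> (g x)"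
proof -
  obtain N r k where r: "0 < r" "ball x0 r \<subseteq> \<Omega>" and N: "mink N N = 0" "snd (snd N) = 1"
    and Nf: "\<And>x. x \<in> ball x0 r \<Longrightarrow> mink N (f x) = k"
    by (rule lies_on_null_hyperplane[OF assms(1,2)]) (rule that)
  let ?w = "(fst N, fst (snd N))"
  have w: "lorentz ?w ?w = -1" using N by (simp add: mink_lorentz)
  obtain \<epsilon> and L :: "real \<times> (real ^ 'n) \<Rightarrow> real \<times> (real ^ 'n)" where \<epsilon>: "\<epsilon> \<in> {1, -1}" and L: "linear L" "\<And>u v. lorentz (L u) (L v) = lorentz u v"
    and Lw: "\<And>v. lorentz ?w v = - \<epsilon> * fst (L v)"
    and Lpos: "\<And>v. 0 < fst v \<Longrightarrow> norm (snd v) = fst v \<Longrightarrow> 0 < fst (L v)"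
    using rotate_timelike_to_axis[OF w] by blast
  have \<epsilon>2: "\<epsilon> * \<epsilon> = 1" using \<epsilon> by auto
  let ?Q = "rotation L"
  have Q: "hyperplane_rotation ?Q" using hyperplane_rotation_rotation[OF L] .
  have Qbl: "bounded_linear ?Q"
    using hyperplane_rotation_linear[OF Q] by (simp add: linear_conv_bounded_linear)
  let ?c = "- \<epsilon> * k"
  let ?B = "ball x0 r"
  have B: "open ?B" "x0 \<in> ?B" "?B \<subseteq> \<Omega>" using r by auto
  have Qf: "fst (?Q (f x)) = \<epsilon> * snd (snd (f x)) + ?c" "0 < fst (?Q (f x))"
    "norm (fst (snd (?Q (f x)))) = fst (?Q (f x))" "snd (snd (?Q (f x))) = snd (snd (f x))"
    if "x \<in> ?B" for x
  proof -
    let ?v = "(fst (f x), fst (snd (f x)))"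
    have c: "0 < fst ?v" "norm (snd ?v) = fst ?v"
      using on_cone[of x] that B(3) by (auto simp: light_cone_cylinder_iff)
    have "lorentz ?w ?v + snd (snd (f x)) = k"
      using Nf[OF that] N(2) by (simp add: mink_lorentz)
    then have "\<epsilon> * (\<epsilon> * fst (L ?v)) = \<epsilon> * (snd (snd (f x)) - k)" unfolding Lw by simp
    then show "fst (?Q (f x)) = \<epsilon> * snd (snd (f x)) + ?c"
      using \<epsilon>2 by (simp add: rotation_def mult.assoc[symmetric] right_diff_distrib)
    show pos: "0 < fst (?Q (f x))" using Lpos[OF c] by (simp add: rotation_def)
    have "lorentz ?v ?v = 0"
      using c by (simp add: lorentz_def power2_norm_eq_inner[symmetric] power2_eq_square[symmetric])
    then have "lorentz (L ?v) (L ?v) = 0" using L(2) by simp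
    then have "(norm (snd (L ?v)))\<^sup>2 = (fst (L ?v))\<^sup>2"
      unfolding power2_norm_eq_inner by (simp add: lorentz_def power2_eq_square)
    then show "norm (fst (snd (?Q (f x)))) = fst (?Q (f x))"
      using pos power2_eq_iff_nonneg[of "norm (snd (L ?v))" "fst (L ?v)"] by (simp add: rotation_def)
    show "snd (snd (?Q (f x))) = snd (snd (f x))" by (simp add: rotation_def)
  qed
  let ?dir = "\<lambda>x. inverse (fst (?Q (f x))) *\<^sub>R fst (snd (?Q (f x)))"
  have norm_dir: "norm (?dir x) = 1" if "x \<in> ?B" for x
    using Qf(2,3)[OF that] by simp
  obtain pole and \<beta> :: "'k \<Rightarrow> 'n" where st: "stereographic pole \<beta>" and pole: "?dir x0 $ pole \<noteq> 1"
    using ex_stereographic[OF assms(3) norm_dir[OF B(2)]] .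
  interpret stereographic pole \<beta> by (rule st)
  have sf: "smooth_on ?B f" by (rule smooth_on_subset[OF smooth B(3)])
  have sQf: "smooth_on ?B (\<lambda>x. ?Q (f x))" by (rule smooth_on_linear[OF B(1) Qbl sf])
  have sdir: "smooth_on ?B ?dir"
    using Qf(2) by (intro smooth_on_bilinear[OF B(1) bounded_bilinear_scaleR] smooth_on_inverse B(1)
      smooth_on_linear[OF B(1) bounded_linear_fst] smooth_on_linear[OF B(1) bounded_linear_snd] sQf) force
  let ?S = "?B \<inter> ?dir -` {y. y $ pole \<noteq> 1}"
  have Y: "open {y :: real^'n. y $ pole \<noteq> 1}"
    by (intro open_Collect_neq continuous_intros)
  have S: "open ?S" "x0 \<in> ?S" "?S \<subseteq> ?B"
    using continuous_open_preimage[OF smooth_on_imp_continuous[OF sdir] B(1) Y] B(2) pole by auto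
  define g where "g x = (snd (snd (f x)), proj (?dir x))" for x
  have sg: "smooth_on ?S g"
    unfolding g_def
  proof (rule smooth_on_Pair[OF S(1)])
    show "smooth_on ?S (\<lambda>x. snd (snd (f x)))"
      by (intro smooth_on_linear[OF S(1) bounded_linear_snd] smooth_on_subset[OF sf S(3)])
    show "smooth_on ?S (\<lambda>x. proj (?dir x))"
      by (rule smooth_on_compose[OF S(1) Y smooth_proj[OF Y] smooth_on_subset[OF sdir S(3)]]) auto
  qed
  let ?\<Phi> = "cone_parametrization \<epsilon> ?c param"
  have \<Phi>g: "?\<Phi> (g x) = ?Q (f x)" if "x \<in> ?S" for x
  proof -
    have x: "x \<in> ?B" "?dir x $ pole \<noteq> 1" using that by auto
    have "fst (?Q (f x)) *\<^sub>R ?dir x = fst (snd (?Q (f x)))" using Qf(2)[OF x(1)] by simp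
    then show ?thesis
      using param_proj[OF norm_dir[OF x(1)] x(2)] Qf(1,4)[OF x(1)]
      by (simp add: g_def prod_eq_iff)
  qed
  have "inj (frechet_derivative g (at x0))"
  proof -
    have dg: "(g has_derivative frechet_derivative g (at x0)) (at x0)"
      by (rule smooth_on_has_derivative[OF sg S(1,2)])
    have d\<Phi>: "(?\<Phi> has_derivative frechet_derivative ?\<Phi> (at (g x0))) (at (g x0))"
      by (rule smooth_on_has_derivative[OF smooth_cone_parametrization[OF smooth_param]]) auto
    have 1: "((\<lambda>x. ?\<Phi> (g x)) has_derivative (\<lambda>v. frechet_derivative ?\<Phi> (at (g x0)) (frechet_derivative g (at x0) v))) (at x0)"
      by (rule has_derivative_compose[OF dg d\<Phi>])
    have 2: "((\<lambda>x. ?\<Phi> (g x)) has_derivative (\<lambda>v. ?Q (d x0 v))) (at x0)"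
      by (rule has_derivative_transform_within_open[OF bounded_linear.has_derivative[OF Qbl f_has_derivative[OF assms(1)]] S(1,2)])
        (rule \<Phi>g[symmetric])
    have eq: "frechet_derivative ?\<Phi> (at (g x0)) (frechet_derivative g (at x0) v) = ?Q (d x0 v)" for v
      using fun_cong[OF has_derivative_unique[OF 1 2]] .
    show ?thesis
    proof (rule injI)
      fix u v assume "frechet_derivative g (at x0) u = frechet_derivative g (at x0) v"
      then have "?Q (d x0 u) = ?Q (d x0 v)" using eq by metis
      then show "u = v"
        using hyperplane_rotation_inj[OF Q] spacelike_inj[OF spacelike[OF assms(1)]] by (meson injD)
    qed
  qed
  from smooth_local_inverse[OF S(1,2) sg _ this]
  obtain U W g' where U: "open U" "U \<subseteq> ?S" "x0 \<in> U" and W: "open W" and hom: "homeomorphism U W g g'"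
    and sg': "smooth_on W g'"
    using assms(3) by auto
  have gU: "W = g ` U" using hom by (simp add: homeomorphism_def)
  have WW: "W \<subseteq> {(s, t). 0 < \<epsilon> * s + ?c}"
  proof -
    have "g x \<in> {(s, t). 0 < \<epsilon> * s + ?c}" if "x \<in> U" for x
    proof -
      have "x \<in> ?B" by (rule subsetD[OF S(3) subsetD[OF U(2) that]])
      from Qf(1,2)[OF this] show ?thesis by (simp add: g_def)
    qed
    then show ?thesis unfolding gU by (rule image_subsetI)
  qed
  show ?thesis
  proof (rule that[OF Q \<epsilon> sphere_parametrization_param U(1,3) _ W WW hom smooth_on_subset[OF sg U(2)] sg'])
    show "U \<subseteq> \<Omega>" by (rule subset_trans[OF U(2) subset_trans[OF S(3) B(3)]])
    show "?Q (f x) = ?\<Phi> (g x)" if "x \<in> U" for x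
      by (rule \<Phi>g[OF subsetD[OF U(2) that], symmetric])
  qed
qed

section \<open>From charts to immersions of open sets\<close>

locale manifold_with_charts =
  fixes M :: "'m topology" and A :: "('m, 'c::euclidean_space) chart set"
  assumes smooth_manifold: "smooth_manifold M A"
begin

lemma chart:
  assumes "(U, \<psi>) \<in> A"
  shows chart_openin: "openin M U" and chart_open: "open (\<psi> ` U)"
    and chart_homeomorphic: "homeomorphic_map (subtopology M U) (top_of_set (\<psi> ` U)) \<psi>"
  using smooth_manifold assms unfolding smooth_manifold_def by auto

lemma chart_inj:
  assumes "(U, \<psi>) \<in> A" shows "inj_on \<psi> U"
proof -
  have "topspace (subtopology M U) = U"
    using openin_subset[OF chart_openin[OF assms]] by (rule topspace_subtopology_subset)
  then show ?thesis using homeomorphic_imp_injective_map[OF chart_homeomorphic[OF assms]] by metis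
qed

lemma chart_inv: "(U, \<psi>) \<in> A \<Longrightarrow> p \<in> U \<Longrightarrow> inv_into U \<psi> (\<psi> p) = p"
  by (simp add: chart_inj)

lemma chart_image_open:
  assumes "(U, \<psi>) \<in> A" "openin M S"
  shows "open (\<psi> ` (U \<inter> S))"
proof -
  have "openin (subtopology M U) (U \<inter> S)"
    using assms(2) by (rule openin_subtopology_Int2)
  then have "openin (top_of_set (\<psi> ` U)) (\<psi> ` (U \<inter> S))"
    using homeomorphic_imp_open_map[OF chart_homeomorphic[OF assms(1)]] by (simp add: open_map_def)
  then show ?thesis using chart_open[OF assms(1)] openin_open_eq by blast
qed

lemma chart_preimage_open:
  assumes "(U, \<psi>) \<in> A" "open S"
  shows "openin M {q \<in> U. \<psi> q \<in> S}"
proof -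
  have "openin (subtopology M U) {q \<in> topspace (subtopology M U). \<psi> q \<in> \<psi> ` U \<inter> S}"
    using openin_continuous_map_preimage[OF homeomorphic_imp_continuous_map[OF chart_homeomorphic[OF assms(1)]], of "\<psi> ` U \<inter> S"]
      assms(2) by (simp add: openin_open_Int)
  also have "{q \<in> topspace (subtopology M U). \<psi> q \<in> \<psi> ` U \<inter> S} = {q \<in> U. \<psi> q \<in> S}"
    using openin_subset[OF chart_openin[OF assms(1)]] by (auto simp: topspace_subtopology_subset)
  finally show ?thesis
    using chart_openin[OF assms(1)] openin_trans_full by blast
qed

lemma chart_at:
  assumes "p \<in> topspace M" shows "\<exists>U \<psi>. (U, \<psi>) \<in> A \<and> p \<in> U"
proof -
  have "(\<Union>(U, \<psi>)\<in>A. U) = topspace M"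
    using smooth_manifold unfolding smooth_manifold_def by blast
  then have "p \<in> (\<Union>(U, \<psi>)\<in>A. U)" using assms by blast
  then obtain c where "c \<in> A" "p \<in> (case c of (U, \<psi>) \<Rightarrow> U)" by blast
  then show ?thesis by (cases c) auto
qed

lemma transition_smooth:
  "(U, \<psi>) \<in> A \<Longrightarrow> (V, \<psi>') \<in> A \<Longrightarrow> smooth_on (\<psi> ` (U \<inter> V)) (\<psi>' \<circ> inv_into U \<psi>)"
  using smooth_manifold unfolding smooth_manifold_def by blast

lemma smooth_map_local_rep:
  assumes "smooth_map A S F" "openin M S" "(U, \<psi>) \<in> A"
  shows "smooth_on (\<psi> ` (U \<inter> S)) (F \<circ> inv_into U \<psi>)" "open (\<psi> ` (U \<inter> S))"
  using assms chart_image_open by (auto simp: smooth_map_def)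

lemma smooth_map_has_derivative:
  assumes "smooth_map A S F" "openin M S" "(U, \<psi>) \<in> A" "p \<in> U" "p \<in> S"
  shows "((F \<circ> inv_into U \<psi>) has_derivative chart_deriv (U, \<psi>) F p) (at (\<psi> p))"
  using smooth_on_has_derivative[OF smooth_map_local_rep[OF assms(1-3)], of "\<psi> p"] assms(4,5) by auto

text \<open>The chain rule for a change of chart. It is the reason why tangent spaces and ambient derivatives
can be computed in any single chart.\<close>

lemma chart_deriv_transition:
  assumes F: "smooth_map A S F" "openin M S" "p \<in> S"
    and U: "(U, \<psi>) \<in> A" "p \<in> U" and V: "(V, \<psi>') \<in> A" "p \<in> V"
  shows "chart_deriv (U, \<psi>) F p = chart_deriv (V, \<psi>') F p \<circ> chart_deriv (U, \<psi>) \<psi>' p"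
proof -
  have op: "open (\<psi> ` (U \<inter> V))" by (rule chart_image_open[OF U(1) chart_openin[OF V(1)]])
  have x: "\<psi> p \<in> \<psi> ` (U \<inter> V)" using U V by blast
  have dJ: "((\<psi>' \<circ> inv_into U \<psi>) has_derivative chart_deriv (U, \<psi>) \<psi>' p) (at (\<psi> p))"
    using smooth_on_has_derivative[OF transition_smooth[OF U(1) V(1)] op x] by simp
  have "((F \<circ> inv_into V \<psi>') has_derivative chart_deriv (V, \<psi>') F p) (at ((\<psi>' \<circ> inv_into U \<psi>) (\<psi> p)))"
    using smooth_map_has_derivative[OF F(1,2) V F(3)] chart_inv[OF U] by simp
  from has_derivative_compose[OF dJ this]
  have "((\<lambda>x. (F \<circ> inv_into V \<psi>') ((\<psi>' \<circ> inv_into U \<psi>) x)) has_derivative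
      (\<lambda>v. chart_deriv (V, \<psi>') F p (chart_deriv (U, \<psi>) \<psi>' p v))) (at (\<psi> p))" .
  then have "((F \<circ> inv_into U \<psi>) has_derivative
      (\<lambda>v. chart_deriv (V, \<psi>') F p (chart_deriv (U, \<psi>) \<psi>' p v))) (at (\<psi> p))"
    by (rule has_derivative_transform_within_open[OF _ op x])
      (auto simp: chart_inv[OF U(1)] chart_inv[OF V(1)])
  from has_derivative_unique[OF smooth_map_has_derivative[OF F(1,2) U F(3)] this]
  show ?thesis by (simp add: o_def)
qed

text \<open>Fields given by a formula in one chart are smooth in all charts, by composition with the transition
maps.\<close>

lemma smooth_map_of_chart:
  assumes U: "(U, \<psi>) \<in> A" and S: "openin M S" "S \<subseteq> U" and \<xi>: "smooth_on (\<psi> ` S) \<xi>"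
  shows "smooth_map A S (\<xi> \<circ> \<psi>)"
  unfolding smooth_map_def
proof clarify
  fix V \<psi>' assume V: "(V, \<psi>') \<in> A"
  have op: "open (\<psi>' ` (V \<inter> S))" by (rule chart_image_open[OF V S(1)])
  have "open (\<psi> ` (U \<inter> S))" by (rule chart_image_open[OF U S(1)])
  moreover have "U \<inter> S = S" using S(2) by blast
  ultimately have op': "open (\<psi> ` S)" by simp
  have tr: "smooth_on (\<psi>' ` (V \<inter> S)) (\<psi> \<circ> inv_into V \<psi>')"
    by (rule smooth_on_subset[OF transition_smooth[OF V U]]) (use S(2) in blast)
  have "(\<psi> \<circ> inv_into V \<psi>') ` (\<psi>' ` (V \<inter> S)) \<subseteq> \<psi> ` S"
    by (auto simp: chart_inv[OF V])
  from smooth_on_compose[OF op op' \<xi> tr this]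
  show "smooth_on (\<psi>' ` (V \<inter> S)) ((\<xi> \<circ> \<psi>) \<circ> inv_into V \<psi>')"
    by (simp add: o_def)
qed

end

locale cone_submanifold = manifold_with_charts M A
  for M :: "'m topology" and A :: "('m, real ^ 'n::finite) chart set" +
  fixes \<phi> :: "'m \<Rightarrow> 'n minkowski"
  assumes riemannian: "riemannian_submanifold M A \<phi>"
    and in_cone: "\<phi> ` topspace M \<subseteq> light_cone_cylinder"
begin

lemma smooth_\<phi>: "smooth_map A (topspace M) \<phi>"
  using riemannian by (simp add: riemannian_submanifold_def)

lemma chart_subset: "(U, \<psi>) \<in> A \<Longrightarrow> U \<subseteq> topspace M"
  using openin_subset[OF chart_openin] .

abbreviation D :: "'m set \<Rightarrow> ('m \<Rightarrow> real ^ 'n) \<Rightarrow> 'm \<Rightarrow> real ^ 'n \<Rightarrow> 'n minkowski" where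
  "D U \<psi> p \<equiv> chart_deriv (U, \<psi>) \<phi> p"

lemma tangent_space_chart:
  assumes U: "(U, \<psi>) \<in> A" "p \<in> U"
  shows "tangent_space A \<phi> p = range (D U \<psi> p)"
proof
  show "range (D U \<psi> p) \<subseteq> tangent_space A \<phi> p"
    unfolding tangent_space_def using U by (intro UN_upper) auto
  show "tangent_space A \<phi> p \<subseteq> range (D U \<psi> p)"
    unfolding tangent_space_def
  proof (rule UN_least)
    fix c assume "c \<in> {c \<in> A. p \<in> fst c}"
    then obtain V \<psi>' where c: "c = (V, \<psi>')" and V: "(V, \<psi>') \<in> A" "p \<in> V" by (cases c) auto
    have "p \<in> topspace M" using chart_subset[OF U(1)] U(2) by blast
    show "range (chart_deriv c \<phi> p) \<subseteq> range (D U \<psi> p)"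
      unfolding c chart_deriv_transition[OF smooth_\<phi> openin_topspace \<open>p \<in> topspace M\<close> V U] image_comp[symmetric]
      by (rule image_mono) (rule subset_UNIV)
  qed
qed

lemma D_has_derivative:
  assumes "(U, \<psi>) \<in> A" "p \<in> U"
  shows "((\<phi> \<circ> inv_into U \<psi>) has_derivative D U \<psi> p) (at (\<psi> p))"
  using smooth_map_has_derivative[OF smooth_\<phi> openin_topspace assms] chart_subset[OF assms(1)] assms(2) by blast

lemma spacelike_D:
  assumes U: "(U, \<psi>) \<in> A" "p \<in> U"
  shows "spacelike (D U \<psi> p)"
  unfolding spacelike_def
proof (intro conjI allI impI)
  show lin: "linear (D U \<psi> p)" by (rule has_derivative_linear[OF D_has_derivative[OF assms]])
  fix v :: "real ^ 'n" assume "v \<noteq> 0"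
  moreover have "inj (D U \<psi> p)"
    using riemannian U unfolding riemannian_submanifold_def by (metis fst_conv)
  ultimately have "D U \<psi> p v \<noteq> 0" using lin linear_injective_0 by blast
  moreover have "D U \<psi> p v \<in> tangent_space A \<phi> p" using tangent_space_chart[OF U] by blast
  ultimately show "0 < mink (D U \<psi> p v) (D U \<psi> p v)"
    using riemannian chart_subset[OF U(1)] U(2) unfolding riemannian_submanifold_def by blast
qed

lemma cone_immersion_chart:
  assumes U: "(U, \<psi>) \<in> A"
  shows "cone_immersion (\<phi> \<circ> inv_into U \<psi>) (\<psi> ` U)"
proof
  show "open (\<psi> ` U)" by (rule chart_open[OF U])
  show "smooth_on (\<psi> ` U) (\<phi> \<circ> inv_into U \<psi>)"
    using smooth_map_local_rep(1)[OF smooth_\<phi> openin_topspace U] chart_subset[OF U] by (simp add: Int_absorb2)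
  fix x assume "x \<in> \<psi> ` U"
  then obtain p where p: "p \<in> U" "x = \<psi> p" by blast
  show "spacelike (frechet_derivative (\<phi> \<circ> inv_into U \<psi>) (at x))"
    using spacelike_D[OF U p(1)] p(2) by simp
  show "(\<phi> \<circ> inv_into U \<psi>) x \<in> light_cone_cylinder"
    using in_cone chart_subset[OF U] p by (auto simp: chart_inv[OF U])
qed

lemma normal_space_chart:
  assumes "(U, \<psi>) \<in> A" "p \<in> U"
  shows "normal_space A \<phi> p = {w. \<forall>v. mink (D U \<psi> p v) w = 0}"
  unfolding normal_space_def tangent_space_chart[OF assms] by blast

lemma tangential_part_chart:
  assumes "(U, \<psi>) \<in> A" "p \<in> U"
  shows "tangential_part A \<phi> p w = D U \<psi> p (tangent_coords (D U \<psi> p) w)"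
  unfolding tangential_part_def
proof (rule the_equality)
  let ?D = "D U \<psi> p"
  note sp = spacelike_D[OF assms]
  show "?D (tangent_coords ?D w) \<in> tangent_space A \<phi> p \<and> w - ?D (tangent_coords ?D w) \<in> normal_space A \<phi> p"
    unfolding tangent_space_chart[OF assms] normal_space_chart[OF assms]
    using tangent_coords_normal[OF sp] by simp
  fix v assume v: "v \<in> tangent_space A \<phi> p \<and> w - v \<in> normal_space A \<phi> p"
  then obtain c where c: "v = ?D c" unfolding tangent_space_chart[OF assms] by blast
  have "c = tangent_coords ?D w"
    using v unfolding c normal_space_chart[OF assms] by (intro tangent_coords_unique[OF sp]) blast
  then show "v = ?D (tangent_coords ?D w)" using c by simp
qed

lemma normal_part_chart:
  assumes "(U, \<psi>) \<in> A" "p \<in> U"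
  shows "normal_part A \<phi> p w = w - D U \<psi> p (tangent_coords (D U \<psi> p) w)"
  by (simp only: normal_part_def tangential_part_chart[OF assms])

lemma normal_part_normal:
  assumes "(U, \<psi>) \<in> A" "p \<in> U"
  shows "mink (D U \<psi> p v) (normal_part A \<phi> p w) = 0"
  unfolding normal_part_chart[OF assms] by (rule tangent_coords_normal[OF spacelike_D[OF assms]])

text \<open>The form needed for a rescaled field \<open>aX\<close>, whose derivative is \<open>a\<close> times that of \<open>X\<close> up to a multiple
of \<open>X\<close>.\<close>

lemma normal_part_add_tangent:
  assumes "(U, \<psi>) \<in> A" "p \<in> U"
  shows "normal_part A \<phi> p (a *\<^sub>R w + D U \<psi> p u) = a *\<^sub>R normal_part A \<phi> p w"
proof -
  let ?D = "D U \<psi> p"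
  note sp = spacelike_D[OF assms] note lin = spacelike_linear[OF sp]
  have D: "?D (a *\<^sub>R tangent_coords ?D w + u) = a *\<^sub>R ?D (tangent_coords ?D w) + ?D u"
    by (simp only: linear_add[OF lin] linear_scale[OF lin])
  have "a *\<^sub>R tangent_coords ?D w + u = tangent_coords ?D (a *\<^sub>R w + ?D u)"
  proof (rule tangent_coords_unique[OF sp])
    fix v
    have "(a *\<^sub>R w + ?D u) - ?D (a *\<^sub>R tangent_coords ?D w + u) = a *\<^sub>R (w - ?D (tangent_coords ?D w))"
      unfolding D by (simp add: algebra_simps)
    then show "mink (?D v) ((a *\<^sub>R w + ?D u) - ?D (a *\<^sub>R tangent_coords ?D w + u)) = 0"
      using tangent_coords_normal[OF sp, of v w] by (simp only: mink.scaleR_right) simp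
  qed
  from arg_cong[OF this[symmetric], of ?D] show ?thesis
    unfolding normal_part_chart[OF assms] D by (simp only:) (simp add: algebra_simps)
qed

lemma ambient_deriv_chart:
  assumes F: "smooth_map A S F" "openin M S" "p \<in> S" and U: "(U, \<psi>) \<in> A" "p \<in> U"
  shows "ambient_deriv A \<phi> p (D U \<psi> p a) F = chart_deriv (U, \<psi>) F p a"
  unfolding ambient_deriv_def
proof (rule the_equality)
  show "\<exists>c\<in>A. \<exists>b. p \<in> fst c \<and> chart_deriv c \<phi> p b = D U \<psi> p a \<and> chart_deriv c F p b = chart_deriv (U, \<psi>) F p a"
    using U by (intro bexI[of _ "(U, \<psi>)"] exI[of _ a]) auto
  fix w assume "\<exists>c\<in>A. \<exists>b. p \<in> fst c \<and> chart_deriv c \<phi> p b = D U \<psi> p a \<and> chart_deriv c F p b = w"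
  then obtain V \<psi>' b where V: "(V, \<psi>') \<in> A" "p \<in> V" and b: "D V \<psi>' p b = D U \<psi> p a"
    and w: "chart_deriv (V, \<psi>') F p b = w" by (metis fst_conv surj_pair)
  have p: "p \<in> topspace M" using chart_subset[OF U(1)] U(2) by blast
  let ?J = "chart_deriv (V, \<psi>') \<psi> p"
  have "D U \<psi> p (?J b) = D U \<psi> p a"
    using b chart_deriv_transition[OF smooth_\<phi> openin_topspace p V U] by simp
  then have "?J b = a" using spacelike_inj[OF spacelike_D[OF U]] by (meson injD)
  then show "w = chart_deriv (U, \<psi>) F p a"
    using w chart_deriv_transition[OF F V U] by simp
qed

lemma smooth_theta_field: "smooth_map A (topspace M) (theta_field \<phi>)"
  unfolding smooth_map_def
proof clarify
  fix V \<psi>' assume V: "(V, \<psi>') \<in> A"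
  have "theta_field \<phi> \<circ> inv_into V \<psi>' = (\<lambda>x. horizontal ((\<phi> \<circ> inv_into V \<psi>') x))"
    by (simp add: theta_field_eq[abs_def] o_def)
  then show "smooth_on (\<psi>' ` (V \<inter> topspace M)) (theta_field \<phi> \<circ> inv_into V \<psi>')"
    using smooth_on_linear[OF smooth_map_local_rep(2)[OF smooth_\<phi> openin_topspace V] linear_horizontal
        smooth_map_local_rep(1)[OF smooth_\<phi> openin_topspace V]] by simp
qed

text \<open>If \<open>\<partial>\<close> is tangent, then \<open>e\<^sub>1 = \<partial>\<close>, and \<open>\<theta>\<close> has derivative zero in this direction because the
derivative of \<open>\<theta>\<close> is the horizontal part of the direction.\<close>

lemma alpha_eq_0_of_vertical_tangent:
  assumes U: "(U, \<psi>) \<in> A" "p \<in> U" and vert: "vertical \<in> range (D U \<psi> p)"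
  shows "alpha A \<phi> p = 0"
proof -
  let ?D = "D U \<psi> p"
  note sp = spacelike_D[OF U]
  have p: "p \<in> topspace M" using chart_subset[OF U(1)] U(2) by blast
  obtain u where u: "vertical = ?D u" using vert by blast
  have "u = tangent_coords ?D vertical"
    by (rule tangent_coords_unique[OF sp]) (simp add: u mink.zero_right)
  then have e1: "e1_field A \<phi> p = ?D u"
    unfolding e1_field_def tangential_part_chart[OF U] by simp
  have "((\<lambda>x. horizontal ((\<phi> \<circ> inv_into U \<psi>) x)) has_derivative (\<lambda>v. horizontal (?D v))) (at (\<psi> p))"
    by (rule bounded_linear.has_derivative[OF linear_horizontal D_has_derivative[OF U]])
  moreover have "(\<lambda>x. horizontal ((\<phi> \<circ> inv_into U \<psi>) x)) = theta_field \<phi> \<circ> inv_into U \<psi>"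
    by (simp add: theta_field_eq[abs_def] o_def)
  ultimately have "chart_deriv (U, \<psi>) (theta_field \<phi>) p u = horizontal (?D u)"
    using frechet_derivative_at by (metis chart_deriv.simps)
  also have "\<dots> = 0" unfolding u[symmetric] by (simp add: horizontal_def zero_prod_def)
  finally have "ambient_deriv A \<phi> p (e1_field A \<phi> p) (theta_field \<phi>) = 0"
    unfolding e1 using ambient_deriv_chart[OF smooth_theta_field openin_topspace p U] by simp
  moreover have "normal_part A \<phi> p 0 = 0"
    using normal_part_add_tangent[OF U, of 0 0 0] linear_0[OF spacelike_linear[OF sp]] by simp
  ultimately have "normal_connection A \<phi> (e1_field A \<phi>) (theta_field \<phi>) p = 0"
    by (simp add: normal_connection_def)
  moreover have "theta_field \<phi> p \<noteq> 0"
    unfolding theta_field_eq using in_cone p by (intro horizontal_null(1)) blast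
  ultimately show ?thesis by (simp add: alpha_def)
qed

text \<open>Isotropy speaks of smooth unit fields. A coordinate vector \<open>u\<close> gives such a field on the whole chart
domain, the normalized \<open>d\<phi>(u)\<close>; the derivative of the normalizing factor contributes only a tangent
vector.\<close>

lemma isotropic_normal_curvature:
  assumes iso: "isotropic M A \<phi> l" and U: "(U, \<psi>) \<in> A" "p \<in> U"
  defines "f \<equiv> \<phi> \<circ> inv_into U \<psi>"
  shows "mink (normal_curvature f (\<psi> p) u) (normal_curvature f (\<psi> p) u) = l p * (mink (D U \<psi> p u) (D U \<psi> p u))\<^sup>2"
proof (cases "u = 0")
  interpret cone_immersion f "\<psi> ` U"
    unfolding f_def by (rule cone_immersion_chart[OF U(1)])
  have x: "\<psi> p \<in> \<psi> ` U" using U by blast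
  have dD: "d (\<psi> q) = D U \<psi> q" for q by (simp add: f_def)
  {
    case True
    have "second_derivative f (\<psi> p) 0 0 = 0"
      using linear_0[OF second_derivative_linear[OF x]] .
    moreover have "tangent_coords (d (\<psi> p)) 0 = 0"
      by (rule tangent_coords_unique[symmetric, OF spacelike[OF x]])
        (simp add: linear_0[OF linear_d[OF x]] mink.zero_right)
    ultimately have "normal_curvature f (\<psi> p) 0 = 0"
      by (simp add: normal_curvature_def linear_0[OF linear_d[OF x]])
    then show ?thesis
      using True linear_0[OF linear_d[OF x]] by (simp add: dD mink.zero_left)
  next
    case False
    let ?q = "\<lambda>y. mink (d y u) (d y u)"
    let ?s = "\<lambda>y. inverse (sqrt (?q y))"
    have q: "0 < ?q y" if "y \<in> \<psi> ` U" for y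
      using spacelike[OF that] False by (simp add: spacelike_def)
    define \<xi> where "\<xi> y = ?s y *\<^sub>R d y u" for y
    have ss: "smooth_on (\<psi> ` U) ?s"
    proof (rule smooth_on_inverse[OF open_domain])
      show "smooth_on (\<psi> ` U) (\<lambda>y. sqrt (?q y))"
        using q by (intro smooth_on_sqrt[OF open_domain] smooth_on_bilinear[OF open_domain bounded_bilinear_mink] smooth_d)
      show "sqrt (?q y) \<noteq> 0" if "y \<in> \<psi> ` U" for y using q[OF that] by simp
    qed
    have s\<xi>: "smooth_on (\<psi> ` U) \<xi>"
      unfolding \<xi>_def by (rule smooth_on_bilinear[OF open_domain bounded_bilinear_scaleR ss smooth_d])
    let ?X = "\<xi> \<circ> \<psi>"
    have sX: "smooth_map A U ?X"
      by (rule smooth_map_of_chart[OF U(1) chart_openin[OF U(1)] subset_refl s\<xi>])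
    have X: "?X q = D U \<psi> q (?s (\<psi> q) *\<^sub>R u)" if "q \<in> U" for q
      unfolding dD[symmetric] using that by (subst linear_scale[OF linear_d]) (simp_all add: \<xi>_def)
    have "?X q \<in> tangent_space A \<phi> q \<and> mink (?X q) (?X q) = 1" if "q \<in> U" for q
    proof
      show "?X q \<in> tangent_space A \<phi> q"
        unfolding tangent_space_chart[OF U(1) that] X[OF that] by blast
      have "mink (?X q) (?X q) = ?s (\<psi> q) * ?s (\<psi> q) * ?q (\<psi> q)"
        by (simp add: \<xi>_def mink.scaleR_left mink.scaleR_right)
      also have "\<dots> = inverse (sqrt (?q (\<psi> q)) * sqrt (?q (\<psi> q))) * ?q (\<psi> q)"
        by (simp only: inverse_mult_distrib)
      also have "\<dots> = 1" using q[of "\<psi> q"] that by simp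
      finally show "mink (?X q) (?X q) = 1" .
    qed
    then have h: "mink (second_fundamental_form A \<phi> ?X ?X p) (second_fundamental_form A \<phi> ?X ?X p) = l p"
      using iso sX chart_openin[OF U(1)] U(2) unfolding isotropic_def by blast
    let ?x = "\<psi> p" and ?c = "?s (\<psi> p)"
    let ?Ds = "frechet_derivative ?s (at ?x)"
    have d\<xi>: "(\<xi> has_derivative (\<lambda>v. ?c *\<^sub>R second_derivative f ?x u v + ?Ds v *\<^sub>R d ?x u)) (at ?x)"
      unfolding \<xi>_def
      by (rule bounded_bilinear.FDERIV[OF bounded_bilinear_scaleR smooth_on_has_derivative[OF ss open_domain x] d_has_derivative[OF x]])
    have "((?X \<circ> inv_into U \<psi>) has_derivative (\<lambda>v. ?c *\<^sub>R second_derivative f ?x u v + ?Ds v *\<^sub>R d ?x u)) (at ?x)"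
      by (rule has_derivative_transform_within_open[OF d\<xi> open_domain x]) (auto simp: chart_inv[OF U(1)])
    from frechet_derivative_at[OF this]
    have dX: "chart_deriv (U, \<psi>) ?X p = (\<lambda>v. ?c *\<^sub>R second_derivative f ?x u v + ?Ds v *\<^sub>R d ?x u)"
      unfolding chart_deriv.simps by (rule sym)
    have "second_fundamental_form A \<phi> ?X ?X p = normal_part A \<phi> p (chart_deriv (U, \<psi>) ?X p (?c *\<^sub>R u))"
      unfolding second_fundamental_form_def X[OF U(2)]
      by (simp only: ambient_deriv_chart[OF sX chart_openin[OF U(1)] U(2) U])
    also have "chart_deriv (U, \<psi>) ?X p (?c *\<^sub>R u) = (?c * ?c) *\<^sub>R second_derivative f ?x u u + D U \<psi> p (?Ds (?c *\<^sub>R u) *\<^sub>R u)"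
      unfolding dX dD[symmetric]
      by (simp only: linear_scale[OF second_derivative_linear[OF x]] linear_scale[OF linear_d[OF x]] scaleR_scaleR)
    also have "normal_part A \<phi> p \<dots> = (?c * ?c) *\<^sub>R normal_part A \<phi> p (second_derivative f ?x u u)"
      by (rule normal_part_add_tangent[OF U])
    also have "normal_part A \<phi> p (second_derivative f ?x u u) = normal_curvature f ?x u"
      by (simp only: normal_part_chart[OF U] normal_curvature_def dD)
    finally have "l p = (?c * ?c) * ((?c * ?c) * mink (normal_curvature f ?x u) (normal_curvature f ?x u))"
      using h by (simp only: mink.scaleR_left mink.scaleR_right real_scaleR_def)
    also have "?c * ?c = inverse (?q ?x)"
      using q[OF x] by (simp add: inverse_mult_distrib[symmetric] del: inverse_mult_distrib)
    finally have "l p * (?q ?x)\<^sup>2 = mink (normal_curvature f ?x u) (normal_curvature f ?x u)"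
      using q[OF x] by (simp add: power2_eq_square field_simps)
    then show ?thesis by (simp add: dD)
  }
qed

text \<open>Taking \<open>e\<^sub>1\<close> as the unit vector, where the second fundamental form is light-like anyway, shows \<open>\<lambda> = 0\<close>.\<close>

lemma isotropic_imp_isotropic_cone_immersion:
  assumes iso: "isotropic M A \<phi> l" and \<alpha>: "\<And>p. p \<in> topspace M \<Longrightarrow> alpha A \<phi> p \<noteq> 0" and U: "(U, \<psi>) \<in> A"
  shows "isotropic_cone_immersion (\<phi> \<circ> inv_into U \<psi>) (\<psi> ` U)"
proof -
  let ?f = "\<phi> \<circ> inv_into U \<psi>"
  interpret cone_immersion ?f "\<psi> ` U" by (rule cone_immersion_chart[OF U])
  show ?thesis
  proof
    fix x assume x: "x \<in> \<psi> ` U"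
    then obtain p where p: "p \<in> U" "x = \<psi> p" by blast
    have dD: "d x = D U \<psi> p" by (simp add: p)
    show "vertical \<notin> range (d x)"
      using alpha_eq_0_of_vertical_tangent[OF U p(1)] \<alpha>[of p] chart_subset[OF U] p(1) dD by auto
    have "l p = 0"
      using isotropic_normal_curvature[OF iso U p(1), of "E x"] normal_curvature_E_null[OF x] unit_E[OF x]
      by (simp add: dD[symmetric] p(2)[symmetric])
    then show "mink (normal_curvature ?f x u) (normal_curvature ?f x u) = 0" for u
      using isotropic_normal_curvature[OF iso U p(1), of u] by (simp add: p(2))
  qed
qed

end

section \<open>The characterization of isotropic submanifolds\<close>

text \<open>The local normal form of a chart representation, transported to the manifold by the chart.\<close>

lemma (in cone_submanifold) isotropic_imp_congruent:
  assumes n: "1 < CARD('n)" "CARD('n) = CARD('k::finite) + 1"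
    and iso: "isotropic M A \<phi> l" and \<alpha>: "\<And>p. p \<in> topspace M \<Longrightarrow> alpha A \<phi> p \<noteq> 0" and p: "p \<in> topspace M"
  shows "\<exists>N c\<^sub>0 \<epsilon> T W. \<exists>\<Theta> :: real ^ 'k \<Rightarrow> real ^ 'n.
       openin M N \<and> p \<in> N \<and> \<epsilon> \<in> {1, -1} \<and>
       sphere_parametrization T \<Theta> \<and>
       open W \<and> W \<subseteq> {(s, t). t \<in> T \<and> 0 < \<epsilon> * s + c\<^sub>0} \<and>
       congruent_to_parametrized M A \<phi> N W (cone_parametrization \<epsilon> c\<^sub>0 \<Theta>)"
proof -
  obtain U \<psi> where U: "(U, \<psi>) \<in> A" "p \<in> U" using chart_at[OF p] by blast
  interpret isotropic_cone_immersion "\<phi> \<circ> inv_into U \<psi>" "\<psi> ` U"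
    by (rule isotropic_imp_isotropic_cone_immersion[OF iso \<alpha> U(1)])
  have x0: "\<psi> p \<in> \<psi> ` U" using U(2) by blast
  obtain Q \<epsilon> c S W g g' and \<Theta> :: "real ^ 'k \<Rightarrow> real ^ 'n" where
    Q: "hyperplane_rotation Q" and \<epsilon>: "\<epsilon> \<in> {1, -1}" and \<Theta>: "sphere_parametrization UNIV \<Theta>"
    and S: "open S" "\<psi> p \<in> S" "S \<subseteq> \<psi> ` U" and W: "open W" "W \<subseteq> {(s, t). 0 < \<epsilon> * s + c}"
    and hom: "homeomorphism S W g g'" and sg: "smooth_on S g" and sg': "smooth_on W g'"
    and Qf: "\<And>x. x \<in> S \<Longrightarrow> Q ((\<phi> \<circ> inv_into U \<psi>) x) = cone_parametrization \<epsilon> c \<Theta> (g x)"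
    by (rule local_cone_form[OF x0 n]) blast
  define N where "N = {q \<in> U. \<psi> q \<in> S}"
  have N: "openin M N" "p \<in> N" "N \<subseteq> U"
    using chart_preimage_open[OF U(1) S(1)] U(2) S(2) by (auto simp: N_def)
  have \<psi>N: "\<psi> ` N = S" using S(3) by (auto simp: N_def)
  let ?\<gamma> = "g \<circ> \<psi>"
  have gS: "g ` S = W" and g'g: "\<And>x. x \<in> S \<Longrightarrow> g' (g x) = x" and cg': "continuous_on W g'"
    using hom by (auto simp: homeomorphism_def)
  have inj\<gamma>: "inj_on ?\<gamma> N"
  proof (rule inj_onI)
    fix q r assume q: "q \<in> N" and r: "r \<in> N" and eq: "?\<gamma> q = ?\<gamma> r"
    have "g' (g (\<psi> q)) = g' (g (\<psi> r))" using eq by simp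
    then have "\<psi> q = \<psi> r" using q r g'g by (simp add: N_def)
    then show "q = r" by (rule inj_onD[OF chart_inj[OF U(1)] _ subsetD[OF N(3) q] subsetD[OF N(3) r]])
  qed
  have hom\<gamma>: "homeomorphic_map (subtopology M N) (top_of_set W) ?\<gamma>"
  proof (rule homeomorphic_map_compose)
    have "homeomorphic_map (subtopology (subtopology M U) N) (subtopology (top_of_set (\<psi> ` U)) S) \<psi>"
    proof (rule homeomorphic_map_subtopologies[OF chart_homeomorphic[OF U(1)]])
      show "\<psi> ` (topspace (subtopology M U) \<inter> N) = topspace (top_of_set (\<psi> ` U)) \<inter> S"
        using N(3) S(3) \<psi>N chart_subset[OF U(1)] by (auto simp: N_def)
    qed
    moreover have "U \<inter> N = N" "\<psi> ` U \<inter> S = S" using N(3) S(3) by auto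
    ultimately show "homeomorphic_map (subtopology M N) (top_of_set S) \<psi>"
      by (simp add: subtopology_subtopology)
    show "homeomorphic_map (top_of_set S) (top_of_set W) g"
      unfolding homeomorphic_map_maps using hom
      by (intro exI[of _ g']) (auto simp: homeomorphic_maps_def homeomorphism_def continuous_map_in_subtopology)
  qed
  have sm: "smooth_map A N ?\<gamma>"
    using sg by (intro smooth_map_of_chart[OF U(1) N(1,3)]) (simp add: \<psi>N)
  have sm': "smooth_on (?\<gamma> ` (N \<inter> V)) (\<psi>' \<circ> inv_into N ?\<gamma>)" if V: "(V, \<psi>') \<in> A" for V \<psi>'
  proof -
    have NV: "openin M (N \<inter> V)" by (rule openin_Int[OF N(1) chart_openin[OF V]])
    have "U \<inter> (N \<inter> V) = N \<inter> V" using N(3) by blast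
    then have op1: "open (\<psi> ` (N \<inter> V))" using chart_image_open[OF U(1) NV] by simp
    have "?\<gamma> ` (N \<inter> V) = W \<inter> g' -` (\<psi> ` (N \<inter> V))"
    proof
      show "?\<gamma> ` (N \<inter> V) \<subseteq> W \<inter> g' -` (\<psi> ` (N \<inter> V))"
        using gS g'g by (auto simp: N_def)
      show "W \<inter> g' -` (\<psi> ` (N \<inter> V)) \<subseteq> ?\<gamma> ` (N \<inter> V)"
      proof
        fix w assume w: "w \<in> W \<inter> g' -` (\<psi> ` (N \<inter> V))"
        then obtain q where q: "q \<in> N \<inter> V" "g' w = \<psi> q" by auto
        have "g (g' w) = w" using hom w by (auto simp: homeomorphism_def)
        then show "w \<in> ?\<gamma> ` (N \<inter> V)" using q by force
      qed
    qed
    then have op2: "open (?\<gamma> ` (N \<inter> V))"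
      using continuous_open_preimage[OF cg' W(1) op1] by simp
    have sub: "?\<gamma> ` (N \<inter> V) \<subseteq> W" using gS by (auto simp: N_def)
    have tr: "smooth_on (\<psi> ` (N \<inter> V)) (\<psi>' \<circ> inv_into U \<psi>)"
      by (rule smooth_on_subset[OF transition_smooth[OF U(1) V]]) (use N(3) in blast)
    have "g' ` (?\<gamma> ` (N \<inter> V)) \<subseteq> \<psi> ` (N \<inter> V)" using g'g by (auto simp: N_def)
    from smooth_on_compose[OF op2 op1 tr smooth_on_subset[OF sg' sub] this]
    have "smooth_on (?\<gamma> ` (N \<inter> V)) (\<lambda>w. (\<psi>' \<circ> inv_into U \<psi>) (g' w))" .
    then show ?thesis
    proof (rule smooth_on_cong[OF _ op2])
      fix w assume "w \<in> ?\<gamma> ` (N \<inter> V)"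
      then obtain q where q: "q \<in> N" "w = ?\<gamma> q" by blast
      have "inv_into N ?\<gamma> w = q" unfolding q(2) by (rule inv_into_f_f[OF inj\<gamma> q(1)])
      moreover have "inv_into U \<psi> (g' w) = q"
        using q g'g by (simp add: N_def chart_inv[OF U(1)])
      ultimately show "(\<psi>' \<circ> inv_into U \<psi>) (g' w) = (\<psi>' \<circ> inv_into N ?\<gamma>) w" by simp
    qed
  qed
  have "Q (\<phi> q) = cone_parametrization \<epsilon> c \<Theta> (?\<gamma> q)" if "q \<in> N" for q
    using Qf[of "\<psi> q"] that by (simp add: N_def chart_inv[OF U(1)])
  then have "congruent_to_parametrized M A \<phi> N W (cone_parametrization \<epsilon> c \<Theta>)"
    unfolding congruent_to_parametrized_def
    using Q hom\<gamma> sm sm' by (intro exI[of _ Q] exI[of _ ?\<gamma>]) auto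
  moreover have "W \<subseteq> {(s, t). t \<in> UNIV \<and> 0 < \<epsilon> * s + c}" using W(2) by auto
  ultimately show ?thesis
    using N \<epsilon> \<Theta> W(1) by blast
qed

text \<open>Differentiating the hyperplane equation shows that \<open>n\<close> is normal near \<open>p\<close>. Differentiating
\<open>\<langle>X, n\<rangle> = 0\<close> shows that \<open>h(X, X)\<close> is orthogonal to \<open>n\<close>, and in the light-like frame of \<open>\<theta>\<close> and \<open>n\<close>
such a normal vector is a multiple of \<open>n\<close>.\<close>

lemma (in cone_submanifold) second_fundamental_form_null:
  assumes S: "openin M S" "p \<in> S" and null: "mink n n = 0" "snd (snd n) = 1"
    and hyp: "\<And>q. q \<in> S \<Longrightarrow> mink (\<phi> q) n = k" and trans: "mink n (horizontal (\<phi> p)) \<noteq> 0"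
    and X: "openin M R" "smooth_map A R X" "\<And>q. q \<in> R \<Longrightarrow> X q \<in> tangent_space A \<phi> q" "p \<in> R"
  shows "mink (second_fundamental_form A \<phi> X X p) (second_fundamental_form A \<phi> X X p) = 0"
proof -
  have p: "p \<in> topspace M" using openin_subset[OF S(1)] S(2) by blast
  obtain U \<psi> where U: "(U, \<psi>) \<in> A" "p \<in> U" using chart_at[OF p] by blast
  have nD: "mink (D U \<psi> q v) n = 0" if q: "q \<in> U" "q \<in> S" for q v
  proof -
    have "((\<lambda>x. mink ((\<phi> \<circ> inv_into U \<psi>) x) n) has_derivative (\<lambda>v. mink (D U \<psi> q v) n)) (at (\<psi> q))"
      by (rule bounded_linear.has_derivative[OF mink.bounded_linear_left D_has_derivative[OF U(1) q(1)]])
    moreover have "((\<lambda>x. mink ((\<phi> \<circ> inv_into U \<psi>) x) n) has_derivative (\<lambda>v. 0)) (at (\<psi> q))"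
      by (rule has_derivative_transform_within_open[OF has_derivative_const[of k] chart_image_open[OF U(1) S(1)]])
        (use q hyp in \<open>auto simp: chart_inv[OF U(1)]\<close>)
    ultimately have "(\<lambda>v. mink (D U \<psi> q v) n) = (\<lambda>v. 0)" by (rule has_derivative_unique)
    from fun_cong[OF this] show ?thesis .
  qed
  let ?dX = "chart_deriv (U, \<psi>) X p"
  have dX: "((X \<circ> inv_into U \<psi>) has_derivative ?dX) (at (\<psi> p))"
    by (rule smooth_map_has_derivative[OF X(2,1) U X(4)])
  have ndX: "mink (?dX v) n = 0" for v
  proof -
    have "((\<lambda>x. mink ((X \<circ> inv_into U \<psi>) x) n) has_derivative (\<lambda>v. mink (?dX v) n)) (at (\<psi> p))"
      by (rule bounded_linear.has_derivative[OF mink.bounded_linear_left dX])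
    moreover have "((\<lambda>x. mink ((X \<circ> inv_into U \<psi>) x) n) has_derivative (\<lambda>v. 0)) (at (\<psi> p))"
    proof (rule has_derivative_transform_within_open[OF has_derivative_const[of 0] chart_image_open[OF U(1) openin_Int[OF S(1) X(1)]]])
      fix x assume "x \<in> \<psi> ` (U \<inter> (S \<inter> R))"
      then obtain q where q: "q \<in> U" "q \<in> S" "q \<in> R" "x = \<psi> q" by blast
      obtain v where "X q = D U \<psi> q v" using X(3)[OF q(3)] tangent_space_chart[OF U(1) q(1)] by blast
      then show "0 = mink ((X \<circ> inv_into U \<psi>) x) n"
        using nD[OF q(1,2)] by (simp add: q(4) chart_inv[OF U(1) q(1)] del: chart_deriv.simps)
    qed (use U S X in auto)
    ultimately have "(\<lambda>v. mink (?dX v) n) = (\<lambda>v. 0)" by (rule has_derivative_unique)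
    from fun_cong[OF this] show ?thesis .
  qed
  obtain a where a: "X p = D U \<psi> p a" using X(3)[OF X(4)] tangent_space_chart[OF U] by blast
  let ?h = "second_fundamental_form A \<phi> X X p"
  have h: "?h = normal_part A \<phi> p (?dX a)"
    unfolding second_fundamental_form_def a by (simp only: ambient_deriv_chart[OF X(2,1,4) U])
  have hn: "mink ?h n = 0"
    unfolding h normal_part_chart[OF U] mink.diff_left ndX nD[OF U(2) S(2)] by simp
  have cone: "\<phi> p \<in> light_cone_cylinder" using in_cone p by blast
  interpret cone_immersion "\<phi> \<circ> inv_into U \<psi>" "\<psi> ` U" by (rule cone_immersion_chart[OF U(1)])
  have \<theta>: "mink (D U \<psi> p v) (horizontal (\<phi> p)) = 0" for v
    using d_normal_\<theta>[of "\<psi> p" v] U(2) by (simp add: chart_inv[OF U])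
  have "mink (D U \<psi> p v) ?h = 0" for v
    unfolding h by (rule normal_part_normal[OF U])
  then obtain b c where bc: "?h = b *\<^sub>R horizontal (\<phi> p) + c *\<^sub>R n"
    using normal_null_frame[OF spacelike_D[OF U] horizontal_null[OF cone] \<theta> nD[OF U(2) S(2)] trans] by blast
  have "b = 0"
    using hn null(1) trans by (simp add: bc mink.add_left mink.scaleR_left mink_commute[of "horizontal (\<phi> p)" n])
  then show ?thesis using null(1) by (simp add: bc mink.scaleR_left mink.scaleR_right)
qed

text \<open>The parametrized submanifold satisfies \<open>\<langle>(\<epsilon>, 0, 1), x\<rangle> = - \<epsilon> c\<close>; the vector \<open>n\<close> is the preimage of
\<open>(\<epsilon>, 0, 1)\<close> under the rotation.\<close>

lemma congruent_lies_on_null_hyperplane: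
  assumes cong: "congruent_to_parametrized M A \<phi> N W (cone_parametrization \<epsilon> c \<Theta>)"
    and \<epsilon>: "\<epsilon> \<in> {1, -1}" and W: "W \<subseteq> {(s, t). t \<in> T \<and> 0 < \<epsilon> * s + c}" and N: "openin M N"
  obtains n where "mink n n = 0" "snd (snd n) = 1" "\<And>q. q \<in> N \<Longrightarrow> mink (\<phi> q) n = - \<epsilon> * c"
    "\<And>q. q \<in> N \<Longrightarrow> mink n (horizontal (\<phi> q)) \<noteq> 0"
proof -
  obtain Q g where Q: "hyperplane_rotation Q" and g: "homeomorphic_map (subtopology M N) (top_of_set W) g"
    and Qg: "\<And>q. q \<in> N \<Longrightarrow> Q (\<phi> q) = cone_parametrization \<epsilon> c \<Theta> (g q)"
    using cong unfolding congruent_to_parametrized_def by auto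
  note [simp] = hyperplane_rotation_mink[OF Q]
  have \<epsilon>2: "\<epsilon> * \<epsilon> = 1" using \<epsilon> by auto
  have Qsnd: "snd (snd (Q x)) = snd (snd x)" for x
    using Q by (cases x) (auto simp: hyperplane_rotation_def)
  obtain n where n: "Q n = (\<epsilon>, 0, 1)"
    using linear_injective_imp_surjective[OF hyperplane_rotation_linear[OF Q] hyperplane_rotation_inj[OF Q]]
    by (metis surj_def)
  have nn: "mink n n = 0"
    using hyperplane_rotation_mink[OF Q, of n n] \<epsilon>2 by (simp add: n mink_eq)
  have n1: "snd (snd n) = 1" using Qsnd[of n] by (simp add: n)
  have on: "mink (\<phi> q) n = - \<epsilon> * c" "mink n (horizontal (\<phi> q)) \<noteq> 0" if q: "q \<in> N" for q
  proof -
    obtain s t where st: "g q = (s, t)" by (cases "g q")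
    have "q \<in> topspace (subtopology M N)" using q openin_subset[OF N] by auto
    then have "g q \<in> W" using homeomorphic_imp_surjective_map[OF g] by auto
    then have pos: "0 < \<epsilon> * s + c" using W st by auto
    have Q\<phi>: "Q (\<phi> q) = (\<epsilon> * s + c, (\<epsilon> * s + c) *\<^sub>R \<Theta> t, s)" using Qg[OF q] st by simp
    have "mink (\<phi> q) n = mink (Q (\<phi> q)) (Q n)" by simp
    also have "\<dots> = - (\<epsilon> * \<epsilon> * s) - \<epsilon> * c + s"
      unfolding Q\<phi> n by (simp add: mink_eq algebra_simps)
    finally show *: "mink (\<phi> q) n = - \<epsilon> * c" using \<epsilon>2 by simp
    have "snd (snd (\<phi> q)) = s" using Qsnd[of "\<phi> q"] Q\<phi> by simp
    then have "mink n (horizontal (\<phi> q)) = - \<epsilon> * c - s"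
      unfolding horizontal_alt mink.diff_right mink.scaleR_right mink_vertical using * n1
      by (simp add: mink_commute[of n])
    also have "\<dots> = - \<epsilon> * (\<epsilon> * s + c)" using \<epsilon>2 by (simp add: algebra_simps mult.assoc[symmetric])
    finally show "mink n (horizontal (\<phi> q)) \<noteq> 0" using pos \<epsilon>2 by auto
  qed
  show ?thesis by (rule that[OF nn n1 on])
qed

theorem theorem4p5:
  fixes M :: "'m topology"
    and A :: "('m, real ^ 'n::finite) chart set"
    and \<phi> :: "'m \<Rightarrow> 'n minkowski"
  assumes "CARD('n) > 2"
    and "CARD('n) = CARD('k::finite) + 1"
    and "riemannian_submanifold M A \<phi>"
    and "\<phi> ` topspace M \<subseteq> light_cone_cylinder"
    and "\<forall>p\<in>topspace M. alpha A \<phi> p \<noteq> 0"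
  shows "(\<exists>l. isotropic M A \<phi> l) \<longleftrightarrow>
    (\<forall>p\<in>topspace M. \<exists>N c\<^sub>0 \<epsilon> T W. \<exists>\<Theta> :: real ^ 'k \<Rightarrow> real ^ 'n.
       openin M N \<and> p \<in> N \<and> \<epsilon> \<in> {1, -1} \<and>
       sphere_parametrization T \<Theta> \<and>
       open W \<and> W \<subseteq> {(s, t). t \<in> T \<and> 0 < \<epsilon> * s + c\<^sub>0} \<and>
       congruent_to_parametrized M A \<phi> N W (cone_parametrization \<epsilon> c\<^sub>0 \<Theta>))"
    (is "?iso \<longleftrightarrow> (\<forall>p\<in>topspace M. ?congruent p)")
proof
  interpret cone_submanifold M A \<phi>
    using assms(3,4) by unfold_locales (auto simp: riemannian_submanifold_def)
  show "\<forall>p\<in>topspace M. ?congruent p" if ?iso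
  proof
    from that obtain l where iso: "isotropic M A \<phi> l" by blast
    show "?congruent p" if "p \<in> topspace M" for p
      by (rule isotropic_imp_congruent[OF _ assms(2) iso _ that]) (use assms(1,5) in auto)
  qed
  assume cong: "\<forall>p\<in>topspace M. ?congruent p"
  have "isotropic M A \<phi> (\<lambda>_. 0)"
    unfolding isotropic_def
  proof (intro conjI allI impI ballI)
    show "smooth_map A (topspace M) (\<lambda>_. 0 :: real)"
      by (auto simp: smooth_map_def o_def smooth_on_const)
    fix R X p assume R: "openin M R \<and> smooth_map A R X \<and> (\<forall>p\<in>R. X p \<in> tangent_space A \<phi> p \<and> mink (X p) (X p) = 1)"
      and p: "p \<in> R"
    have "p \<in> topspace M" using R p openin_subset by blast
    with cong obtain N c \<epsilon> T W and \<Theta> :: "real ^ 'k \<Rightarrow> real ^ 'n" where N: "openin M N" "p \<in> N" and \<epsilon>: "\<epsilon> \<in> {1, -1}"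
      and W: "W \<subseteq> {(s, t). t \<in> T \<and> 0 < \<epsilon> * s + c}"
      and c: "congruent_to_parametrized M A \<phi> N W (cone_parametrization \<epsilon> c \<Theta>)"
      by meson
    obtain n where n: "mink n n = 0" "snd (snd n) = 1" "\<And>q. q \<in> N \<Longrightarrow> mink (\<phi> q) n = - \<epsilon> * c"
      "\<And>q. q \<in> N \<Longrightarrow> mink n (horizontal (\<phi> q)) \<noteq> 0"
      by (rule congruent_lies_on_null_hyperplane[OF c \<epsilon> W N(1)]) blast
    show "mink (second_fundamental_form A \<phi> X X p) (second_fundamental_form A \<phi> X X p) = 0"
      by (rule second_fundamental_form_null[OF N n(1-3) n(4)[OF N(2)]]) (use R p in auto)
  qed
  then show ?iso by blast
qed

end
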